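(* Let $R$ be an order in a quadratic number field and let $I$ be an ideal of $R$. Then $\mathrm{glr}(I)=2$.
   Context: An order in a quadratic number field is a subring of finite index in its ring of integers. For a finitely generated module $M$ over a commutative unital ring $R$, $\mu(M)$ denotes the minimal number of generators of $M$, and for $k\ge\mu(M)$, $V_k(M)$ denotes the set of $k$-tuples in $M^k$ whose components generate $M$. The group $\mathrm{GL}_k(R)$ acts on $V_k(M)$ by right multiplication of row vectors by matrices. The linear rank $\mathrm{glr}(M)$ is the least integer $n\ge\mu(M)$ such that $\mathrm{GL}_k(R)$ acts transitively on $V_k(M)$ for every $k>n$; the analogous definition with $\mathrm{SL}_k(R)$ (the matrices of determinant $1$) in place of $\mathrm{GL}_k(R)$ yields the same rank.
   Formalization: The ideal I is assumed to be non-principal; for principal I (including 0 and R) the claim fails under the stated definition, since then μ(I) ≤ 1 and GL_2(R) acts transitively on V_2(I), so glr(I) ≠ 2. *)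

theory Defs
  imports
    "HOL-Algebra.Algebraic_Closure_Type"
    "HOL-Library.Extended_Nat"
    "HOL-Library.FuncSet"
begin

section \<open>Generating tuples and the linear rank\<close>

definition generated_submodule ::
    "('a, 'c) ring_scheme \<Rightarrow> ('a, 'b, 'd) module_scheme \<Rightarrow> 'b set \<Rightarrow> 'b set" where
  "generated_submodule R M S = \<Inter> {N. submodule N R M \<and> S \<subseteq> N}"

text \<open>The set $V_k(M)$; a $k$-tuple is an extensional function on $\{0, \dots, k-1\}$.\<close>

definition generating_tuples ::
    "('a, 'c) ring_scheme \<Rightarrow> ('a, 'b, 'd) module_scheme \<Rightarrow> nat \<Rightarrow> (nat \<Rightarrow> 'b) set" where
  "generating_tuples R M k =
     {v \<in> {..<k} \<rightarrow>\<^sub>E carrier M. generated_submodule R M (v ` {..<k}) = carrier M}"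

text \<open>The infimum is \<open>\<infinity>\<close> when \<open>M\<close> is not finitely generated.\<close>

definition min_generators ::
    "('a, 'c) ring_scheme \<Rightarrow> ('a, 'b, 'd) module_scheme \<Rightarrow> enat" where
  "min_generators R M = Inf {enat k |k. generating_tuples R M k \<noteq> {}}"

text \<open>The multiplicative monoid of $k \times k$ matrices over \<open>R\<close>; $\mathrm{GL}_k(R)$ is its
  group of units.\<close>

definition matrix_monoid :: "('a, 'c) ring_scheme \<Rightarrow> nat \<Rightarrow> (nat \<times> nat \<Rightarrow> 'a) monoid" where
  "matrix_monoid R k =
     \<lparr>carrier = {..<k} \<times> {..<k} \<rightarrow>\<^sub>E carrier R,
      monoid.mult = (\<lambda>A B. \<lambda>(i, j)\<in>{..<k} \<times> {..<k}. \<Oplus>\<^bsub>R\<^esub>l\<in>{..<k}. A (i, l) \<otimes>\<^bsub>R\<^esub> B (l, j)),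
      monoid.one = (\<lambda>(i, j)\<in>{..<k} \<times> {..<k}. if i = j then \<one>\<^bsub>R\<^esub> else \<zero>\<^bsub>R\<^esub>)\<rparr>"

definition general_linear :: "('a, 'c) ring_scheme \<Rightarrow> nat \<Rightarrow> (nat \<times> nat \<Rightarrow> 'a) set" where
  "general_linear R k = Units (matrix_monoid R k)"

definition row_times_matrix ::
    "('a, 'b, 'd) module_scheme \<Rightarrow> nat \<Rightarrow> (nat \<Rightarrow> 'b) \<Rightarrow> (nat \<times> nat \<Rightarrow> 'a) \<Rightarrow> nat \<Rightarrow> 'b" where
  "row_times_matrix M k v A = (\<lambda>j\<in>{..<k}. \<Oplus>\<^bsub>M\<^esub>i\<in>{..<k}. A (i, j) \<odot>\<^bsub>M\<^esub> v i)"

definition GL_transitive ::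
    "('a, 'c) ring_scheme \<Rightarrow> ('a, 'b, 'd) module_scheme \<Rightarrow> nat \<Rightarrow> bool" where
  "GL_transitive R M k \<longleftrightarrow>
     (\<forall>v\<in>generating_tuples R M k. \<forall>w\<in>generating_tuples R M k.
        \<exists>A\<in>general_linear R k. row_times_matrix M k v A = w)"

text \<open>With values in \<open>enat\<close>, a finite value of \<open>glr\<close> entails that a least \<open>n\<close> exists.\<close>

definition glr :: "('a, 'c) ring_scheme \<Rightarrow> ('a, 'b, 'd) module_scheme \<Rightarrow> enat" where
  "glr R M = Inf {enat n |n. min_generators R M \<le> enat n \<and> (\<forall>k>n. GL_transitive R M k)}"

text \<open>An ideal as a module over its ring. The fields \<open>mult\<close> and \<open>one\<close> are required by the
  record type but play no role in the module structure.\<close>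

definition ideal_module :: "('a, 'c) ring_scheme \<Rightarrow> 'a set \<Rightarrow> ('a, 'a) module" where
  "ideal_module R I =
     \<lparr>carrier = I, monoid.mult = monoid.mult R, one = \<one>\<^bsub>R\<^esub>, zero = \<zero>\<^bsub>R\<^esub>,
      add = add R, module.smult = monoid.mult R\<rparr>"


section \<open>Orders in quadratic number fields\<close>

text \<open>Number fields are taken as subfields of an arbitrary ambient field of characteristic 0.\<close>

definition quadratic_number_field :: "'a :: field_char_0 set \<Rightarrow> bool" where
  "quadratic_number_field K \<longleftrightarrow>
     subfield K ring_of_type_algebra \<and> ring.dimension ring_of_type_algebra 2 \<rat> K"

definition ring_of_integers :: "'a :: field_char_0 set \<Rightarrow> 'a set" where
  "ring_of_integers K = {x \<in> K. algebraic_int x}"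

abbreviation ring_on :: "'a :: field_char_0 set \<Rightarrow> 'a ring" where
  "ring_on S \<equiv> ring_of_type_algebra\<lparr>carrier := S\<rparr>"

definition order_in :: "'a :: field_char_0 set \<Rightarrow> 'a set \<Rightarrow> bool" where
  "order_in K R \<longleftrightarrow>
     subring R (ring_on (ring_of_integers K)) \<and>
     finite (a_rcosets\<^bsub>ring_on (ring_of_integers K)\<^esub> R)"


section \<open>Principal ideals\<close>

text \<open>Over a domain, no principal ideal has linear rank 2: such an ideal has $\mu \le 1$ and
  $\mathrm{GL}_2$ acts transitively on its generating pairs, so 2 is never the least admissible
  integer. For example $\mathrm{glr}(0) = 0$.\<close>

lemma (in cring) ideal_module_is_module:
  assumes "ideal I R"
  shows "module R (ideal_module R I)"
proof -
  interpret I: ideal I R by fact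
  have sub: "I \<subseteq> carrier R" by (rule I.a_subset)
  note c = subsetD[OF sub]
  show ?thesis
  proof (rule moduleI)
    show "cring R" by (rule is_cring)
    show "abelian_group (ideal_module R I)"
    proof (rule abelian_groupI)
      fix x assume "x \<in> carrier (ideal_module R I)"
      then have x: "x \<in> I" by (simp add: ideal_module_def)
      then have "\<ominus> x \<in> I" "\<ominus> x \<oplus> x = \<zero>" using c by (auto simp: l_neg)
      then show "\<exists>y\<in>carrier (ideal_module R I).
          y \<oplus>\<^bsub>ideal_module R I\<^esub> x = \<zero>\<^bsub>ideal_module R I\<^esub>"
        by (auto simp: ideal_module_def)
    qed (use c in \<open>auto simp: ideal_module_def a_ac\<close>)
  qed (use c in \<open>auto simp: ideal_module_def l_distr r_distr m_assoc I.I_l_closed\<close>)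
qed

lemma (in cring) det_one_imp_general_linear_2:
  assumes abcd: "a \<in> carrier R" "b \<in> carrier R" "c \<in> carrier R" "d \<in> carrier R"
    and det: "a \<otimes> d \<ominus> b \<otimes> c = \<one>"
  defines "M2 \<equiv> \<lambda>x y z w. \<lambda>(i, j)\<in>{..<2::nat} \<times> {..<2::nat}.
     if i = 0 then (if j = 0 then x else y) else (if j = 0 then z else w)"
  shows "M2 a b c d \<in> general_linear R 2"
proof -
  have two: "{..<2::nat} = {0, 1}" by auto
  have mult: "M2 x y z w \<otimes>\<^bsub>matrix_monoid R 2\<^esub> M2 x' y' z' w' =
      M2 (x \<otimes> x' \<oplus> y \<otimes> z') (x \<otimes> y' \<oplus> y \<otimes> w') (z \<otimes> x' \<oplus> w \<otimes> z') (z \<otimes> y' \<oplus> w \<otimes> w')"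
    if "{x, y, z, w, x', y', z', w'} \<subseteq> carrier R" for x y z w x' y' z' w'
    using that by (auto simp: M2_def matrix_monoid_def two fun_eq_iff restrict_def)
  have one: "\<one>\<^bsub>matrix_monoid R 2\<^esub> = M2 \<one> \<zero> \<zero> \<one>"
    by (auto simp: M2_def matrix_monoid_def two fun_eq_iff restrict_def)
  have car: "M2 x y z w \<in> carrier (matrix_monoid R 2)"
    if "{x, y, z, w} \<subseteq> carrier R" for x y z w
    using that by (auto simp: M2_def matrix_monoid_def)
  have e: "a \<otimes> d \<oplus> b \<otimes> (\<ominus> c) = \<one>" "a \<otimes> (\<ominus> b) \<oplus> b \<otimes> a = \<zero>"
     "c \<otimes> d \<oplus> d \<otimes> (\<ominus> c) = \<zero>" "c \<otimes> (\<ominus> b) \<oplus> d \<otimes> a = \<one>"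
     "d \<otimes> a \<oplus> (\<ominus> b) \<otimes> c = \<one>" "d \<otimes> b \<oplus> (\<ominus> b) \<otimes> d = \<zero>"
     "(\<ominus> c) \<otimes> a \<oplus> a \<otimes> c = \<zero>" "(\<ominus> c) \<otimes> b \<oplus> a \<otimes> d = \<one>"
    unfolding det[symmetric] using abcd by algebra+
  show ?thesis
    unfolding general_linear_def Units_def
    using abcd e car by (auto simp: mult one intro!: bexI[of _ "M2 d (\<ominus> b) (\<ominus> c) a"])
qed

lemma (in domain) GL_transitive_2_of_principalideal:
  assumes "principalideal I R"
  shows "GL_transitive R (ideal_module R I) 2"
proof -
  interpret I: principalideal I R by fact
  interpret M: module R "ideal_module R I"
    by (rule ideal_module_is_module) (rule I.is_ideal)
  obtain a where a: "a \<in> carrier R" and "I = Idl {a}" using I.generate by auto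
  then have I: "I = {r \<otimes> a |r. r \<in> carrier R}"
    using cgenideal_eq_genideal[OF a] by (auto simp: cgenideal_def)
  have aI: "a \<in> I" using a I l_one by (metis (mono_tags, lifting) mem_Collect_eq one_closed)
  have two: "{..<2::nat} = {0, 1}" by auto
  have coords: "\<exists>x y s t. {x, y, s, t} \<subseteq> carrier R \<and> v 0 = x \<otimes> a \<and> v 1 = y \<otimes> a \<and>
      s \<otimes> (x \<otimes> a) \<oplus> t \<otimes> (y \<otimes> a) = a"
    if v: "v \<in> generating_tuples R (ideal_module R I) 2" for v
  proof -
    have vI: "v 0 \<in> I" "v 1 \<in> I"
      using v by (auto simp: generating_tuples_def ideal_module_def)
    then obtain x y where xy: "x \<in> carrier R" "y \<in> carrier R" "v 0 = x \<otimes> a" "v 1 = y \<otimes> a"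
      using I by blast
    define N where "N = {s \<otimes> (x \<otimes> a) \<oplus> t \<otimes> (y \<otimes> a) |s t. s \<in> carrier R \<and> t \<in> carrier R}"
    have NI: "s \<otimes> (x \<otimes> a) \<oplus> t \<otimes> (y \<otimes> a) \<in> N"
      if "s \<in> carrier R" "t \<in> carrier R" for s t using that unfolding N_def by blast
    have N: "submodule N R (ideal_module R I)"
    proof (rule M.submoduleI)
      show "N \<subseteq> carrier (ideal_module R I)"
        using vI xy I.I_l_closed by (auto simp: N_def ideal_module_def)
      have "\<zero> = \<zero> \<otimes> (x \<otimes> a) \<oplus> \<zero> \<otimes> (y \<otimes> a)" using a xy by simp
      then show "\<zero>\<^bsub>ideal_module R I\<^esub> \<in> N" unfolding N_def ideal_module_def by force
    next
      fix p q assume "p \<in> N" "q \<in> N"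
      then obtain s t s' t' where st: "{s, t, s', t'} \<subseteq> carrier R"
        "p = s \<otimes> (x \<otimes> a) \<oplus> t \<otimes> (y \<otimes> a)" "q = s' \<otimes> (x \<otimes> a) \<oplus> t' \<otimes> (y \<otimes> a)"
        by (auto simp: N_def)
      then have "p \<oplus> q = (s \<oplus> s') \<otimes> (x \<otimes> a) \<oplus> (t \<oplus> t') \<otimes> (y \<otimes> a)"
        using a xy by (simp, algebra)
      then show "p \<oplus>\<^bsub>ideal_module R I\<^esub> q \<in> N"
        using st NI[of "s \<oplus> s'" "t \<oplus> t'"] by (simp add: ideal_module_def)
    next
      fix r p assume r: "r \<in> carrier R" and "p \<in> N"
      then obtain s t where st: "{s, t} \<subseteq> carrier R" "p = s \<otimes> (x \<otimes> a) \<oplus> t \<otimes> (y \<otimes> a)"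
        by (auto simp: N_def)
      then have "r \<otimes> p = (r \<otimes> s) \<otimes> (x \<otimes> a) \<oplus> (r \<otimes> t) \<otimes> (y \<otimes> a)"
        using a xy r by (simp, algebra)
      then show "r \<odot>\<^bsub>ideal_module R I\<^esub> p \<in> N"
        using st r NI[of "r \<otimes> s" "r \<otimes> t"] by (simp add: ideal_module_def)
    next
      fix p assume pN: "p \<in> N"
      then obtain s t where st: "{s, t} \<subseteq> carrier R" "p = s \<otimes> (x \<otimes> a) \<oplus> t \<otimes> (y \<otimes> a)"
        by (auto simp: N_def)
      have pI: "p \<in> I" using pN vI xy I.I_l_closed by (auto simp: N_def)
      have "\<ominus>\<^bsub>ideal_module R I\<^esub> p = \<ominus> p"
      proof (rule M.minus_equality)
        show "\<ominus> p \<oplus>\<^bsub>ideal_module R I\<^esub> p = \<zero>\<^bsub>ideal_module R I\<^esub>"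
          using pI I.a_subset by (auto simp: ideal_module_def l_neg)
      qed (use pI in \<open>auto simp: ideal_module_def\<close>)
      also have "\<dots> = (\<ominus> s) \<otimes> (x \<otimes> a) \<oplus> (\<ominus> t) \<otimes> (y \<otimes> a)"
        using a xy st by (simp, algebra)
      finally show "\<ominus>\<^bsub>ideal_module R I\<^esub> p \<in> N"
        using st NI[of "\<ominus> s" "\<ominus> t"] by simp
    qed
    have "x \<otimes> a = \<one> \<otimes> (x \<otimes> a) \<oplus> \<zero> \<otimes> (y \<otimes> a)" "y \<otimes> a = \<zero> \<otimes> (x \<otimes> a) \<oplus> \<one> \<otimes> (y \<otimes> a)"
      using a xy by simp_all
    then have "v ` {..<2} \<subseteq> N"
      unfolding two using xy NI[of \<one> \<zero>] NI[of \<zero> \<one>] by auto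
    with N have "generated_submodule R (ideal_module R I) (v ` {..<2}) \<subseteq> N"
      unfolding generated_submodule_def by auto
    then have "I \<subseteq> N" using v by (simp add: generating_tuples_def ideal_module_def)
    with aI have "a \<in> N" by auto
    then obtain s t where "s \<in> carrier R" "t \<in> carrier R"
       "s \<otimes> (x \<otimes> a) \<oplus> t \<otimes> (y \<otimes> a) = a"
      unfolding N_def by auto
    then show ?thesis using xy by (intro exI[of _ x] exI[of _ y] exI[of _ s] exI[of _ t]) auto
  qed
  have cancel: "x \<otimes> s \<oplus> y \<otimes> t = \<one>"
    if "{x, y, s, t} \<subseteq> carrier R" "s \<otimes> (x \<otimes> a) \<oplus> t \<otimes> (y \<otimes> a) = a" "a \<noteq> \<zero>" for x y s t
  proof -
    have "(x \<otimes> s \<oplus> y \<otimes> t) \<otimes> a = s \<otimes> (x \<otimes> a) \<oplus> t \<otimes> (y \<otimes> a)"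
      using that(1) a by (simp, algebra)
    also have "\<dots> = \<one> \<otimes> a" using that a by simp
    finally show ?thesis using m_rcancel[of a "x \<otimes> s \<oplus> y \<otimes> t" \<one>] that a by auto
  qed
  show ?thesis
    unfolding GL_transitive_def
  proof (intro ballI)
    fix v w
    assume v: "v \<in> generating_tuples R (ideal_module R I) 2"
      and w: "w \<in> generating_tuples R (ideal_module R I) 2"
    obtain x y s t where V: "{x, y, s, t} \<subseteq> carrier R" "v 0 = x \<otimes> a" "v 1 = y \<otimes> a"
      "s \<otimes> (x \<otimes> a) \<oplus> t \<otimes> (y \<otimes> a) = a" using coords[OF v] by auto
    obtain p q u m where W: "{p, q, u, m} \<subseteq> carrier R" "w 0 = p \<otimes> a" "w 1 = q \<otimes> a"
      "u \<otimes> (p \<otimes> a) \<oplus> m \<otimes> (q \<otimes> a) = a" using coords[OF w] by auto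
    have wext: "w \<in> extensional {..<2}" using w by (auto simp: generating_tuples_def PiE_def)
    define M2 where "M2 \<equiv> \<lambda>x y z w. \<lambda>(i, j)\<in>{..<2::nat} \<times> {..<2::nat}.
       if i = 0 then (if j = 0 then x else y) else (if j = 0 then z else w :: 'a)"
    have act: "row_times_matrix (ideal_module R I) 2 v (M2 b c d e) = w"
      if "{b, c, d, e} \<subseteq> carrier R" "b \<otimes> (x \<otimes> a) \<oplus> d \<otimes> (y \<otimes> a) = p \<otimes> a"
         "c \<otimes> (x \<otimes> a) \<oplus> e \<otimes> (y \<otimes> a) = q \<otimes> a" for b c d e
    proof (rule extensionalityI[OF _ wext])
      fix j assume "j \<in> {..<2::nat}"
      moreover have "x \<otimes> a \<in> I" "y \<otimes> a \<in> I" using V(1) I by blast+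
      moreover have "x \<otimes> a \<in> carrier (ideal_module R I)" "y \<otimes> a \<in> carrier (ideal_module R I)"
        using calculation by (auto simp: ideal_module_def)
      moreover have "\<And>r z. r \<in> carrier R \<Longrightarrow> z \<in> I \<Longrightarrow> r \<odot>\<^bsub>ideal_module R I\<^esub> z \<in> carrier (ideal_module R I)"
        by (auto simp: ideal_module_def I.I_l_closed)
      moreover have "r \<odot>\<^bsub>ideal_module R I\<^esub> z = r \<otimes> z" "r \<oplus>\<^bsub>ideal_module R I\<^esub> z = r \<oplus> z"
          "\<zero>\<^bsub>ideal_module R I\<^esub> = \<zero>" for r z
        by (simp_all add: ideal_module_def)
      moreover have "r \<otimes> z \<in> carrier (ideal_module R I)" if "r \<in> carrier R" "z \<in> I" for r z
        using that by (auto simp: ideal_module_def I.I_l_closed)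
      ultimately show "row_times_matrix (ideal_module R I) 2 v (M2 b c d e) j = w j"
        using that V(1) W(1) V(2,3) W(2,3) a
        by (auto simp: row_times_matrix_def two M2_def)
    qed (auto simp: row_times_matrix_def)
    show "\<exists>A\<in>general_linear R 2. row_times_matrix (ideal_module R I) 2 v A = w"
    proof (cases "a = \<zero>")
      case True
      have "M2 \<one> \<zero> \<zero> \<one> \<in> general_linear R 2"
        unfolding M2_def by (rule det_one_imp_general_linear_2) (auto simp: a_minus_def)
      moreover have "row_times_matrix (ideal_module R I) 2 v (M2 \<one> \<zero> \<zero> \<one>) = w"
        using V W True by (intro act) auto
      ultimately show ?thesis by blast
    next
      case False
      have c1: "x \<otimes> s \<oplus> y \<otimes> t = \<one>" using cancel[OF V(1,4) False] .
      have c2: "p \<otimes> u \<oplus> q \<otimes> m = \<one>" using cancel[OF W(1,4) False] .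
      have cl: "x \<in> carrier R" "y \<in> carrier R" "s \<in> carrier R" "t \<in> carrier R"
        "p \<in> carrier R" "q \<in> carrier R" "u \<in> carrier R" "m \<in> carrier R" using V W by auto
      let ?b = "s \<otimes> p \<oplus> y \<otimes> m" and ?c = "s \<otimes> q \<ominus> y \<otimes> u"
      let ?d = "t \<otimes> p \<ominus> x \<otimes> m" and ?e = "t \<otimes> q \<oplus> x \<otimes> u"
      have "?b \<otimes> ?e \<ominus> ?c \<otimes> ?d = (x \<otimes> s \<oplus> y \<otimes> t) \<otimes> (p \<otimes> u \<oplus> q \<otimes> m)"
        using cl by algebra
      also have "\<dots> = \<one>" using c1 c2 by simp
      finally have "M2 ?b ?c ?d ?e \<in> general_linear R 2"
        unfolding M2_def using cl by (intro det_one_imp_general_linear_2) auto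
      moreover have "?b \<otimes> (x \<otimes> a) \<oplus> ?d \<otimes> (y \<otimes> a) = (x \<otimes> s \<oplus> y \<otimes> t) \<otimes> (p \<otimes> a)"
        using cl a by algebra
      moreover have "?c \<otimes> (x \<otimes> a) \<oplus> ?e \<otimes> (y \<otimes> a) = (x \<otimes> s \<oplus> y \<otimes> t) \<otimes> (q \<otimes> a)"
        using cl a by algebra
      ultimately show ?thesis using act[of ?b ?c ?d ?e] c1 cl a by auto
    qed
  qed
qed

lemma (in domain) glr_neq_2_of_principalideal:
  assumes "principalideal I R"
  shows "glr R (ideal_module R I) \<noteq> 2"
proof
  interpret I: principalideal I R by fact
  interpret M: module R "ideal_module R I"
    by (rule ideal_module_is_module) (rule I.is_ideal)
  obtain a where a: "a \<in> carrier R" and Ia: "I = Idl {a}" using I.generate by auto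
  then have aI: "a \<in> I" and I: "I = {r \<otimes> a |r. r \<in> carrier R}"
    using cgenideal_eq_genideal[OF a] cgenideal_self[OF a] by (auto simp: cgenideal_def)
  have "(\<lambda>i\<in>{..<1::nat}. a) \<in> generating_tuples R (ideal_module R I) 1"
  proof -
    have "N = I" if N: "submodule N R (ideal_module R I)" "a \<in> N" for N
    proof
      show "N \<subseteq> I" using M.submoduleE(1)[OF N(1)] by (simp add: ideal_module_def)
      show "I \<subseteq> N"
      proof
        fix z assume "z \<in> I"
        then obtain r where "r \<in> carrier R" "z = r \<otimes> a" using I by blast
        then show "z \<in> N"
          using M.submoduleE(4)[OF N(1) _ N(2), of r] by (simp add: ideal_module_def)
      qed
    qed
    moreover have "submodule I R (ideal_module R I)"
      using M.carrier_is_submodule by (simp add: ideal_module_def)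
    ultimately have "{N. submodule N R (ideal_module R I) \<and> a \<in> N} = {I}" using aI by auto
    then show ?thesis using aI
      by (auto simp: generating_tuples_def generated_submodule_def ideal_module_def lessThan_Suc)
  qed
  then have mu: "min_generators R (ideal_module R I) \<le> enat 1"
    unfolding min_generators_def by (intro Inf_lower) auto
  let ?S = "{enat n |n. min_generators R (ideal_module R I) \<le> enat n \<and>
     (\<forall>k>n. GL_transitive R (ideal_module R I) k)}"
  assume "glr R (ideal_module R I) = 2"
  then have S: "Inf ?S = 2" by (simp add: glr_def)
  then have "?S \<noteq> {}" by (metis Inf_enat_def infinity_ne_i0 enat.distinct(1) numeral_eq_enat)
  then have "Inf ?S \<in> ?S" unfolding Inf_enat_def by (auto intro: LeastI)
  then have tr: "GL_transitive R (ideal_module R I) k" if "k > 2" for k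
    using that unfolding S by (auto simp: numeral_eq_enat)
  have "GL_transitive R (ideal_module R I) k" if "k > 1" for k
    using tr[of k] GL_transitive_2_of_principalideal[OF assms] that by (cases "k = 2") auto
  with mu have "enat 1 \<in> ?S" by blast
  then have "Inf ?S \<le> enat 1" by (rule Inf_lower)
  then show False unfolding S by (simp add: numeral_eq_enat)
qed

end

theory Submission
  imports Defs
begin

text \<open>Since \<open>I\<close> has rank at most 2 over the integers, call \<open>c \<in> I\<close> primitive if \<open>(c, d)\<close> generates \<open>I\<close>
  as an abelian group for some \<open>d\<close>. Let \<open>v\<close> be a generating \<open>k\<close>-tuple of \<open>I\<close> with \<open>k > 2\<close>. As \<open>I\<close> is not
  principal, the entries after the first generate a nonzero ideal \<open>L\<close>, of finite index in \<open>I\<close>. No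
  prime \<open>p\<close> satisfies both \<open>v\<^sub>0 \<in> p I\<close> and \<open>L \<subseteq> p I\<close>, so some element \<open>c\<close> of \<open>v\<^sub>0 + L\<close> avoids all \<open>p I\<close>
  and is primitive. Then \<open>I / R c\<close> is a finite cyclic group, and the same argument makes the second
  entry a generator \<open>e\<close> of it, after which all other entries can be cleared. Finally \<open>(c, e, 0)\<close> and
  \<open>(c', e', 0)\<close> with \<open>c\<close> and \<open>c'\<close> primitive are joined through \<open>(c, e, c')\<close>: the middle entry is changed
  modulo \<open>R c\<close> into a generator of \<open>I / R c'\<close>, and any entry may be replaced arbitrarily as soon as two
  others generate \<open>I\<close>.\<close>

section \<open>Integral elements of a quadratic field\<close>

text \<open>Gauss's lemma. Clear denominators in X^2 - T X + N and let \<open>q\<close> be the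
  primitive part. The monic integer polynomial \<open>p\<close> vanishing at \<open>x\<close> is
  divisible by \<open>q\<close> over the integers, because an irrational \<open>x\<close> is no root
  of a nonzero polynomial of degree at most 1. So the leading coefficient of \<open>q\<close> is a
  unit, and the denominators of \<open>T\<close> and \<open>N\<close> divide their
  numerators.\<close>

lemma algebraic_int_quadratic_coeffs:
  fixes x T N :: "'a :: field_char_0"
  assumes x: "algebraic_int x" "x \<notin> \<rat>" and T: "T \<in> \<rat>" and N: "N \<in> \<rat>"
    and eq: "x ^ 2 = T * x - N"
  shows "T \<in> \<int> \<and> N \<in> \<int>"
proof -
  obtain p where p: "poly (map_poly of_int p) x = 0" "lead_coeff p = 1"
    using x(1) unfolding algebraic_int_altdef_ipoly by auto
  obtain t n where tn: "T = of_rat t" "N = of_rat n"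
    using T N by (auto elim!: Rats_cases)
  obtain a1 b1 where t: "quotient_of t = (a1, b1)" by force
  obtain a2 b2 where n: "quotient_of n = (a2, b2)" by force
  have b: "b1 > 0" "b2 > 0" using quotient_of_denom_pos t n by auto
  have T': "T * of_int b1 = of_int a1" "N * of_int b2 = of_int a2"
    using b quotient_of_div[OF t] quotient_of_div[OF n] tn
    by (auto simp: of_rat_divide)
  \<comment> \<open>By \<open>T'\<close>, this is \<open>b1 * b2\<close> times X^2 - T X +
    N.\<close>
  define q0 where "q0 = [: a2 * b1, - (a1 * b2), b1 * b2 :]"
  define q where "q = primitive_part q0"
  have q0: "q0 \<noteq> 0" "degree q0 = 2" using b by (auto simp: q0_def)
  have ev0: "poly (map_poly of_int q0) x = 0"
  proof -
    have "poly (map_poly of_int q0) x =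
      of_int a2 * of_int b1 - of_int a1 * of_int b2 * x + of_int b1 * of_int b2 * x ^ 2"
      using b by (simp add: q0_def map_poly_pCons power2_eq_square algebra_simps)
    also have "\<dots> = 0" unfolding eq T'[symmetric] by (simp add: algebra_simps)
    finally show ?thesis .
  qed
  have q: "q \<noteq> 0" "degree q = 2" "content q = 1" "q0 = smult (content q0) q"
    using q0 by (auto simp: q_def degree_primitive_part)
  have evq: "poly (map_poly of_int q) x = 0"
  proof -
    have "map_poly of_int q0 = smult (of_int (content q0)) (map_poly of_int q :: 'a poly)"
      by (subst q(4)) (auto simp: poly_eq_iff coeff_map_poly)
    then show ?thesis using ev0 q0 by auto
  qed
  obtain s r where sr: "pseudo_divmod p q = (s, r)" by force
  define c where "c = lead_coeff q ^ (Suc (degree p) - degree q)"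
  have div: "smult c p = q * s + r" "r = 0 \<or> degree r < degree q"
    using pseudo_divmod[OF q(1) sr] by (auto simp: c_def)
  have c0: "c \<noteq> 0" using q(1) by (simp add: c_def)
  define ev where "ev = (\<lambda>f. poly (map_poly of_int f) x)"
  have ev_pCons: "ev (pCons a f) = of_int a + x * ev f" for a f
    by (simp add: ev_def map_poly_pCons)
  have ev_0: "ev 0 = 0" by (simp add: ev_def)
  have ev_add: "ev (f + g) = ev f + ev g" for f g
    by (induction f g rule: poly_induct2) (simp_all add: ev_pCons ev_0 algebra_simps)
  have ev_smult: "ev (smult a f) = of_int a * ev f" for a f
    by (induction f) (simp_all add: ev_pCons ev_0 algebra_simps)
  have ev_mult: "ev (f * g) = ev f * ev g" for f g
    by (induction f) (simp_all add: ev_pCons ev_0 ev_add ev_smult algebra_simps)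
  have "ev r = 0"
    using arg_cong[OF div(1), of ev] p(1) evq by (simp add: ev_add ev_smult ev_mult) (simp add: ev_def)
  have r0: "r = 0"
  proof (rule ccontr)
    assume "r \<noteq> 0"
    then have "degree r < 2" using div(2) q(2) by auto
    then obtain y z where r: "r = [:y, z:]"
      by (metis One_nat_def degree_eq_zeroE less_2_cases_iff degree1_coeffs
          pCons_0_0)
    then have yz: "of_int y + x * of_int z = 0" using \<open>ev r = 0\<close> by (simp add: ev_pCons ev_0)
    have "z \<noteq> 0" using yz r \<open>r \<noteq> 0\<close> by auto
    then have "x = - of_int y / of_int z" using yz by (simp add: field_simps eq_neg_iff_add_eq_0)
    then show False using x(2) by auto
  qed
  \<comment> \<open>Both \<open>p\<close> and \<open>q\<close> are primitive, so the content of
    \<open>s\<close> is that of the pseudo-division factor \<open>c\<close>, and \<open>c\<close>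
    cancels.\<close>
  have "content p = 1"
    using p(2) content_dvd_coeff[of p "degree p"] by (metis dvd_1_iff_1 is_unit_content_iff)
  then have "content s = normalize c"
    using arg_cong[OF div(1), of content] q(3) r0 by (simp add: content_mult)
  then have "c dvd content s" by simp
  then obtain s' where s': "s = [:c:] * s'"
    by (metis const_poly_dvd_iff_dvd_content dvdE)
  have "p = q * s'"
  proof (rule smult_cancel[OF c0])
    show "smult c p = smult c (q * s')" using div(1) r0 s' by simp
  qed
  then have "lead_coeff q * lead_coeff s' = 1"
    using p(2) by (simp add: lead_coeff_mult)
  then have lead: "lead_coeff q dvd 1"
    by (metis dvdI)
  \<comment> \<open>\<open>h\<close> is the leading coefficient of \<open>q0\<close>. As that of
    \<open>q\<close> is a unit, \<open>h\<close> agrees up to a unit with the content and divides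
    every coefficient.\<close>
  define h where "h = content q0 * lead_coeff q"
  have cf: "coeff q0 i = content q0 * coeff q i" for i
    by (subst q(4)) simp
  have h: "h = b1 * b2" "h \<noteq> 0"
    using cf[of 2] q(2) b by (simp_all add: h_def q0_def numeral_2_eq_2)
  have "h dvd coeff q0 i" for i
    unfolding h_def cf using lead by (intro mult_dvd_mono dvd_refl dvd_trans[OF lead one_dvd])
  from this[of 0] this[of 1] have "b1 * b2 dvd a2 * b1" "b1 * b2 dvd a1 * b2"
    unfolding h by (simp_all add: q0_def)
  then have "b2 dvd a2" "b1 dvd a1" using b by (auto simp: mult.commute)
  then obtain m1 m2 where "a1 = b1 * m1" "a2 = b2 * m2" by (auto elim!: dvdE)
  then have "T = of_int m1" "N = of_int m2" using T' b by auto
  then show ?thesis by auto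
qed

section \<open>Subgroups of the integers and of groups with two generators\<close>

lemma int_subgroup_cyclic:
  fixes S :: "int set"
  assumes zero: "0 \<in> S" and diff: "\<And>x y. x \<in> S \<Longrightarrow> y \<in> S \<Longrightarrow> x - y \<in> S"
  shows "\<exists>d\<in>S. \<forall>x\<in>S. d dvd x"
proof (cases "S = {0}")
  case False
  then obtain x where x: "x \<in> S" "x \<noteq> 0" using zero by auto
  have minus: "- y \<in> S" if "y \<in> S" for y using diff[OF zero that] by simp
  have "\<exists>n. n > 0 \<and> int n \<in> S"
    using x minus[OF x(1)] by (intro exI[of _ "nat \<bar>x\<bar>"]) (auto simp: abs_if)
  \<comment> \<open>Division by the least positive element leaves a smaller nonnegative remainder in
    \<open>S\<close>, hence 0.\<close>
  then obtain n where n: "n > 0" "int n \<in> S" "\<And>m. m > 0 \<Longrightarrow> int m \<in> S \<Longrightarrow> n \<le> m"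
    using exists_least_iff[of "\<lambda>n. n > 0 \<and> int n \<in> S"] linorder_not_less by blast
  have add: "y + z \<in> S" if "y \<in> S" "z \<in> S" for y z
    using diff[OF that(1) minus[OF that(2)]] by simp
  have nmult: "int m * int n \<in> S" for m
    by (induction m) (auto simp: zero algebra_simps intro: add n)
  have mult: "m * int n \<in> S" for m
    using nmult minus[OF nmult] by (cases m rule: int_cases2) auto
  have "int n dvd y" if y: "y \<in> S" for y
  proof (rule ccontr)
    assume "\<not> int n dvd y"
    then have "y mod int n \<noteq> 0" by (simp add: dvd_eq_mod_eq_0)
    then have "y mod int n > 0" using n(1) pos_mod_sign[of "int n" y] by linarith
    moreover have "y mod int n \<in> S"
      using diff[OF y mult[of "y div int n"]] by (simp add: minus_div_mult_eq_mod)
    ultimately have "n \<le> nat (y mod int n)" by (intro n(3)) auto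
    moreover have "y mod int n < int n" using n(1) by simp
    ultimately show False using \<open>y mod int n > 0\<close> by linarith
  qed
  with n show ?thesis by blast
qed auto

text \<open>A Hermite normal form: \<open>e1\<close> generates the elements of \<open>I\<close> that
  are integer multiples of \<open>f1\<close>, and the second coordinate of \<open>e2\<close> divides
  all others. Subtracting a multiple of \<open>e2\<close> leaves a multiple of \<open>f1\<close>.
  The set \<open>T\<close> only asks that suitable coordinates exist, so dependent \<open>f1\<close>
  and \<open>f2\<close> are covered.\<close>

lemma subgroup_of_two_generated:
  fixes f1 f2 :: "'a :: comm_ring_1"
  assumes zero: "0 \<in> I" and diff: "\<And>x y. x \<in> I \<Longrightarrow> y \<in> I \<Longrightarrow> x - y \<in> I"
    and I: "\<And>z. z \<in> I \<Longrightarrow> \<exists>s t. z = of_int s * f1 + of_int t * f2"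
  shows "\<exists>e1\<in>I. \<exists>e2\<in>I. \<forall>z\<in>I. \<exists>s t. z = of_int s * e1 + of_int t * e2"
proof -
  have minus: "- y \<in> I" if "y \<in> I" for y using diff[OF zero that] by simp
  have add: "y + z \<in> I" if "y \<in> I" "z \<in> I" for y z
    using diff[OF that(1) minus[OF that(2)]] by simp
  have nmult: "of_nat m * y \<in> I" if "y \<in> I" for m y
    using that by (induction m) (auto simp: zero algebra_simps intro: add)
  have mult: "of_int m * y \<in> I" if "y \<in> I" for m y
    using nmult[OF that] minus[OF nmult[OF that]] by (cases m rule: int_cases2) auto
  define S where "S = {s. of_int s * f1 \<in> I}"
  define T where "T = {t. \<exists>s. of_int s * f1 + of_int t * f2 \<in> I}"
  have "\<exists>d\<in>S. \<forall>x\<in>S. d dvd x"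
    by (rule int_subgroup_cyclic) (auto simp: S_def zero left_diff_distrib intro: diff)
  then obtain a where a: "a \<in> S" "\<And>x. x \<in> S \<Longrightarrow> a dvd x" by blast
  have "\<exists>d\<in>T. \<forall>x\<in>T. d dvd x"
  proof (rule int_subgroup_cyclic)
    show "0 \<in> T" unfolding T_def using zero by (auto intro!: exI[of _ 0])
  next
    fix x y assume "x \<in> T" "y \<in> T"
    then obtain s s' where "of_int s * f1 + of_int x * f2 \<in> I" "of_int s' * f1 + of_int y * f2 \<in> I"
      by (auto simp: T_def)
    from diff[OF this] show "x - y \<in> T"
      unfolding T_def by (auto intro!: exI[of _ "s - s'"] simp: algebra_simps)
  qed
  then obtain d where d: "d \<in> T" "\<And>x. x \<in> T \<Longrightarrow> d dvd x" by blast
  then obtain b where b: "of_int b * f1 + of_int d * f2 \<in> I" by (auto simp: T_def)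
  define e1 where "e1 = of_int a * f1"
  define e2 where "e2 = of_int b * f1 + of_int d * f2"
  have "\<exists>s t. z = of_int s * e1 + of_int t * e2" if z: "z \<in> I" for z
  proof -
    obtain s t where st: "z = of_int s * f1 + of_int t * f2" using I[OF z] by blast
    then have "t \<in> T" using z by (auto simp: T_def)
    then obtain k where k: "t = d * k" using d by blast
    have "z - of_int k * e2 \<in> I" using z b unfolding e2_def by (intro diff mult)
    also have "z - of_int k * e2 = of_int (s - k * b) * f1"
      by (simp add: st k e2_def algebra_simps)
    finally have "s - k * b \<in> S" by (simp add: S_def)
    then obtain m where "s - k * b = a * m" using a by blast
    then have "s = a * m + k * b" by simp
    then have "z = of_int m * e1 + of_int k * e2"
      by (simp add: st k e1_def e2_def algebra_simps)
    then show ?thesis by blast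
  qed
  moreover have "e1 \<in> I" "e2 \<in> I" using a b by (auto simp: e1_def e2_def S_def)
  ultimately show ?thesis by blast
qed

section \<open>Rational coordinates and bounded denominators\<close>

lemma quadratic_number_field_span:
  assumes "quadratic_number_field K"
  shows "\<exists>u1 u2. K = {a * u1 + b * u2 |a b. a \<in> \<rat> \<and> b \<in> \<rat>}"
proof -
  let ?F = "ring_of_type_algebra :: 'a ring"
  interpret ring ?F by (rule ring_from_type_algebra)
  \<comment> \<open>Inverting the inductive \<open>dimension\<close> down to 0 exhibits
    \<open>K\<close> as a line extension of a line extension of the zero space.\<close>
  have "dimension (Suc (Suc 0)) \<rat> K"
    using assms by (simp add: quadratic_number_field_def numeral_2_eq_2)
  then obtain u1 E1 where u1: "dimension (Suc 0) \<rat> E1" "K = line_extension \<rat> u1 E1"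
    by (cases rule: dimension.cases) auto
  then obtain u2 E2 where u2: "dimension 0 \<rat> E2" "E1 = line_extension \<rat> u2 E2"
    by (cases rule: dimension.cases) auto
  have "E2 = {0}" using u2(1)
    by (cases rule: dimension.cases) (simp_all add: ring_of_type_algebra_def)
  have ext: "y \<in> line_extension \<rat> u E \<longleftrightarrow> (\<exists>k\<in>\<rat>. \<exists>v\<in>E. y = k * u + v)" for y u E
    unfolding line_extension_mem_iff by (simp add: ring_of_type_algebra_def)
  have "x \<in> K \<longleftrightarrow> (\<exists>a b. x = a * u1 + b * u2 \<and> a \<in> \<rat> \<and> b \<in> \<rat>)" for x
    unfolding u1(2) u2(2) ext \<open>E2 = {0}\<close> by (simp add: ext Bex_def) blast
  then show ?thesis by (intro exI[of _ u1] exI[of _ u2]) auto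
qed

text \<open>Cramer's rule, applied to the coordinates of \<open>1\<close> and \<open>w\<close> with
  respect to \<open>u1\<close> and \<open>u2\<close>. If the determinant \<open>d\<close> vanished,
  \<open>w\<close> would be a ratio of two rationals.\<close>

lemma two_dim_basis_one:
  fixes K :: "'a :: field_char_0 set"
  assumes K: "K = {a * u1 + b * u2 |a b. a \<in> \<rat> \<and> b \<in> \<rat>}"
    and "1 \<in> K" "w \<in> K" "w \<notin> \<rat>" "x \<in> K"
  shows "\<exists>a\<in>\<rat>. \<exists>b\<in>\<rat>. x = a + b * w"
proof -
  obtain a1 b1 where 1: "1 = a1 * u1 + b1 * u2" "a1 \<in> \<rat>" "b1 \<in> \<rat>" using assms(2) K by auto
  obtain a2 b2 where 2: "w = a2 * u1 + b2 * u2" "a2 \<in> \<rat>" "b2 \<in> \<rat>" using assms(3) K by auto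
  obtain a b where 3: "x = a * u1 + b * u2" "a \<in> \<rat>" "b \<in> \<rat>" using assms(5) K by auto
  define d where "d = a1 * b2 - a2 * b1"
  have d: "d \<in> \<rat>" using 1 2 by (simp add: d_def)
  have d0: "d \<noteq> 0"
  proof
    assume "d = 0"
    have "a1 * w = a2 * (a1 * u1 + b1 * u2) + d * u2"
      "b1 * w = b2 * (a1 * u1 + b1 * u2) - d * u1"
      unfolding d_def 2(1) by (simp_all add: algebra_simps)
    then have "a1 * w = a2" "b1 * w = b2" using \<open>d = 0\<close> 1(1)[symmetric] by simp_all
    moreover have "a1 \<noteq> 0 \<or> b1 \<noteq> 0" using 1 by auto
    ultimately have "w = a2 / a1 \<or> w = b2 / b1" by (auto simp: eq_divide_eq mult.commute)
    then show False using assms(4) 1 2 by (metis Rats_divide)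
  qed
  have du: "d * u1 = b2 * 1 - b1 * w" "d * u2 = a1 * w - a2 * 1"
    unfolding 1(1) 2(1) d_def by (simp_all add: algebra_simps)
  have "d * x = (a * b2 - b * a2) + (b * a1 - a * b1) * w"
    unfolding 3(1) distrib_left mult.left_commute[of d] du by (simp add: algebra_simps)
  then have "x = (a * b2 - b * a2) / d + ((b * a1 - a * b1) / d) * w"
    using d0 by (simp add: add_divide_distrib[symmetric] eq_divide_eq mult.commute)
  moreover have "(a * b2 - b * a2) / d \<in> \<rat>" "(b * a1 - a * b1) / d \<in> \<rat>"
    using 1 2 3 d by simp_all
  ultimately show ?thesis by blast
qed

text \<open>The traces of \<open>x\<close> and \<open>x * w\<close> are integers, and they determine the coordinates of \<open>x\<close>
  up to the discriminant of \<open>w\<close>.\<close>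

lemma integral_ring_in_two_dim:
  fixes R :: "'a :: field_char_0 set"
  assumes K: "K = {a * u1 + b * u2 |a b. a \<in> \<rat> \<and> b \<in> \<rat>}"
    and RK: "R \<subseteq> K" and one: "1 \<in> R" and mult: "\<And>x y. x \<in> R \<Longrightarrow> y \<in> R \<Longrightarrow> x * y \<in> R"
    and alg: "\<And>x. x \<in> R \<Longrightarrow> algebraic_int x"
  shows "\<exists>f1 f2. \<forall>x\<in>R. \<exists>s t. x = of_int s * f1 + of_int t * f2"
proof (cases "R \<subseteq> \<rat>")
  case True
  have "\<exists>s t. x = of_int s * 1 + of_int t * 0" if "x \<in> R" for x
  proof -
    have "x \<in> \<int>" using True that alg rational_algebraic_int_is_int by blast
    then show ?thesis by (auto elim!: Ints_cases)
  qed
  then show ?thesis by blast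
next
  case False
  then obtain w where w: "w \<in> R" "w \<notin> \<rat>" by blast
  have ab: "\<exists>a\<in>\<rat>. \<exists>b\<in>\<rat>. x = a + b * w" if "x \<in> R" for x
    using two_dim_basis_one[OF K _ _ w(2)] RK one w that by blast
  \<comment> \<open>So \<open>T\<close> is the trace and \<open>- N\<close> the norm of
    \<open>w\<close>, and \<open>a + b * w\<close> has trace \<open>2 * a + b * T\<close>.\<close>
  obtain N T where NT: "N \<in> \<rat>" "T \<in> \<rat>" "w * w = N + T * w" using ab mult w by blast
  have trace: "2 * a + b * T \<in> \<int>" if "a + b * w \<in> R" "a \<in> \<rat>" "b \<in> \<rat>" for a b
  proof (cases "b = 0")
    case True
    then have "a \<in> \<int>" using rational_algebraic_int_is_int alg that by auto
    then show ?thesis using True by auto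
  next
    case False
    have irr: "a + b * w \<notin> \<rat>"
    proof
      assume "a + b * w \<in> \<rat>"
      then have "(a + b * w - a) / b \<in> \<rat>" using that by (intro Rats_divide Rats_diff)
      then show False using False w by simp
    qed
    \<comment> \<open>The characteristic equation of \<open>a + b * w\<close>, with its trace and
      norm as coefficients.\<close>
    have "(a + b * w)^2 = (2 * a + b * T) * (a + b * w) - (a^2 + a * b * T - b^2 * N)"
    proof -
      have "(a + b * w)^2 = a^2 + 2 * a * b * w + b^2 * (w * w)"
        by (simp add: power2_eq_square algebra_simps)
      then show ?thesis unfolding NT(3) by (simp add: power2_eq_square algebra_simps)
    qed
    from algebraic_int_quadratic_coeffs[OF alg[OF that(1)] irr _ _ this] that NT
    show ?thesis by simp
  qed
  have T: "T \<in> \<int>" using trace[of 0 1] w by simp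
  \<comment> \<open>The discriminant of X^2 - T X - N. It equals \<open>(2 * w - T)^2\<close>, so it
    is nonzero as \<open>w\<close> is irrational.\<close>
  define D where "D = T^2 + 4 * N"
  have "N + T * w \<in> R" using mult[OF w(1) w(1)] NT(3) by simp
  from trace[OF this NT(1,2)] have "2 * (2 * N + T * T) - T * T \<in> \<int>"
    using T by (intro Ints_diff Ints_mult) auto
  then have D: "D \<in> \<int>" by (simp add: D_def power2_eq_square algebra_simps)
  have D0: "D \<noteq> 0"
  proof
    assume "D = 0"
    have "(2 * w - T)^2 = 4 * (w * w) - 4 * T * w + T^2"
      by (simp add: power2_eq_square algebra_simps)
    also have "\<dots> = D" unfolding NT(3) D_def by (simp add: algebra_simps)
    finally have "w = T / 2" using \<open>D = 0\<close> by (simp add: eq_divide_eq mult.commute)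
    then show False using w(2) NT(2) by (metis Rats_divide Rats_number_of)
  qed
  have "\<exists>s t. x = of_int s * (1 / (2 * D)) + of_int t * (w / (2 * D))" if x: "x \<in> R" for x
  proof -
    obtain a b where x': "x = a + b * w" "a \<in> \<rat>" "b \<in> \<rat>" using ab[OF x] by blast
    have u: "2 * a + b * T \<in> \<int>" using trace x x' by simp
    have "x * w = b * N + (a + b * T) * w"
    proof -
      have "x * w = a * w + b * (w * w)" by (simp add: x' algebra_simps)
      then show ?thesis unfolding NT(3) by (simp add: algebra_simps)
    qed
    then have "b * N + (a + b * T) * w \<in> R" using mult[OF x w(1)] by simp
    then have v: "2 * (b * N) + (a + b * T) * T \<in> \<int>"
      using x' NT by (intro trace) auto
    \<comment> \<open>The traces of \<open>x\<close> and \<open>x * w\<close> are linear forms in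
      \<open>a\<close> and \<open>b\<close> with determinant \<open>D\<close>. Eliminating
      \<open>a\<close> gives \<open>b * D\<close>, and then eliminating \<open>b\<close> gives
      \<open>2 * a * D\<close>.\<close>
    have "2 * (2 * (b * N) + (a + b * T) * T) - T * (2 * a + b * T) \<in> \<int>"
      using u v T by (intro Ints_diff Ints_mult) auto
    also have "2 * (2 * (b * N) + (a + b * T) * T) - T * (2 * a + b * T) = b * D"
      by (simp add: D_def power2_eq_square algebra_simps)
    finally have bD: "b * D \<in> \<int>" .
    have "D * (2 * a + b * T) - T * (b * D) \<in> \<int>"
      by (intro Ints_diff Ints_mult[OF D u] Ints_mult[OF T bD])
    also have "D * (2 * a + b * T) - T * (b * D) = 2 * a * D" by (simp add: algebra_simps)
    finally obtain s where s: "2 * a * D = of_int s" by (auto elim: Ints_cases)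
    have "2 * (b * D) \<in> \<int>" by (intro Ints_mult[OF _ bD]) auto
    then obtain t where t: "2 * (b * D) = of_int t" by (auto elim: Ints_cases)
    have "x = of_int s * (1 / (2 * D)) + of_int t * (w / (2 * D))"
      unfolding x'(1) s[symmetric] t[symmetric] using D0 by (simp add: field_simps)
    then show ?thesis by blast
  qed
  then show ?thesis by blast
qed

section \<open>Nonprincipal ideals of rank 2\<close>

text \<open>The induction step multiplies the correction for the new prime by the product of the
  old primes, so that nothing changes modulo the old ones.\<close>

lemma avoid_subgroups:
  fixes v :: "'a :: comm_ring_1" and P :: "int set"
  assumes P: "finite P" "\<And>p. p \<in> P \<Longrightarrow> prime p"
    and L: "0 \<in> L" "\<And>x y. x \<in> L \<Longrightarrow> y \<in> L \<Longrightarrow> x + y \<in> L"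
      "\<And>x n. x \<in> L \<Longrightarrow> of_int n * x \<in> L"
    and B: "\<And>p x y. p \<in> P \<Longrightarrow> x \<in> B p \<Longrightarrow> y \<in> B p \<Longrightarrow> x + y \<in> B p"
      "\<And>p x n. p \<in> P \<Longrightarrow> x \<in> B p \<Longrightarrow> of_int n * x \<in> B p"
      "\<And>p x. p \<in> P \<Longrightarrow> x \<in> L \<Longrightarrow> of_int p * x \<in> B p"
    and sep: "\<And>p. p \<in> P \<Longrightarrow> v \<in> B p \<Longrightarrow> \<exists>l\<in>L. l \<notin> B p"
  shows "\<exists>l\<in>L. \<forall>p\<in>P. v + l \<notin> B p"
  using P B sep
proof (induction P rule: finite_induct)
  case empty
  then show ?case using L by auto
next
  case (insert p P)
  have "\<exists>l\<in>L. \<forall>p\<in>P. v + l \<notin> B p"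
    using insert.prems by (intro insert.IH) auto
  then obtain l where l: "l \<in> L" "\<And>p'. p' \<in> P \<Longrightarrow> v + l \<notin> B p'" by blast
  have Bdiff: "y \<in> B p'" if "p' \<in> insert p P" "x + y \<in> B p'" "x \<in> B p'" for p' x y
    using insert.prems(2)[OF that(1,2) insert.prems(3)[OF that(1,3), of "-1"]] by simp
  show ?case
  proof (cases "v + l \<in> B p")
    case False
    with l show ?thesis by blast
  next
    case True
    \<comment> \<open>If \<open>l\<close> lies in \<open>B p\<close>, then so does \<open>v\<close>,
      and the separation hypothesis applies; otherwise \<open>l\<close> itself serves.\<close>
    have "\<exists>l'\<in>L. l' \<notin> B p"
    proof (cases "l \<in> B p")
      case True
      have "v \<in> B p"
        by (rule Bdiff[of _ l]) (use True \<open>v + l \<in> B p\<close> in \<open>simp_all add: add.commute\<close>)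
      then show ?thesis using insert.prems(5)[of p] by simp
    qed (use l in blast)
    then obtain l' where l': "l' \<in> L" "l' \<notin> B p" by blast
    define q where "q = \<Prod>P"
    have "coprime q p" unfolding q_def
    proof (rule prod_coprime_left)
      fix p' assume "p' \<in> P"
      then show "coprime p' p" using insert.prems(1) insert.hyps by (intro primes_coprime) auto
    qed
    then obtain s t where st: "s * q + t * p = 1" using bezout_int[of q p] by auto
    \<comment> \<open>By Bezout, having the multiples of \<open>l'\<close> by \<open>q\<close> and
      by \<open>p\<close> both in \<open>B p\<close> would put \<open>l'\<close> there.\<close>
    have "of_int q * l' \<notin> B p"
    proof
      assume "of_int q * l' \<in> B p"
      then have "of_int s * (of_int q * l') + of_int t * (of_int p * l') \<in> B p"
        using l' insert.prems(2-4) by simp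
      also have "of_int s * (of_int q * l') + of_int t * (of_int p * l') = of_int (s * q + t * p) * l'"
        by (simp add: algebra_simps)
      finally show False using l' st by simp
    qed
    then have "v + l + of_int q * l' \<notin> B p"
      using Bdiff[of p "v + l" "of_int q * l'"] True by auto
    moreover have "v + l + of_int q * l' \<notin> B p'" if p': "p' \<in> P" for p'
    proof
      assume *: "v + l + of_int q * l' \<in> B p'"
      have "p' dvd q" unfolding q_def using dvd_prodI[OF insert.hyps(1) p', of id] by simp
      then obtain k where k: "q = p' * k" by (elim dvdE)
      have "of_int q * l' = of_int k * (of_int p' * l')" by (simp add: k algebra_simps)
      then have "of_int q * l' \<in> B p'"
        using insert.prems(3)[of p' "of_int p' * l'" k] insert.prems(4)[of p' l'] p' l' by simp
      then have "v + l \<in> B p'" using Bdiff[of p' "of_int q * l'" "v + l"] * p'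
        by (simp add: add.commute)
      then show False using l p' by blast
    qed
    moreover have "l + of_int q * l' \<in> L" using l(1) l'(1) by (intro L)
    ultimately show ?thesis
      by (intro bexI[of _ "l + of_int q * l'"]) (auto simp: add.assoc)
  qed
qed

lemma not_coprime_int_prime:
  fixes a b :: int
  assumes "\<not> coprime a b"
  shows "\<exists>p. prime p \<and> p dvd a \<and> p dvd b"
proof -
  obtain c where c: "c dvd a" "c dvd b" "\<not> is_unit c" using assms by (elim not_coprimeE)
  show ?thesis
  proof (cases "c = 0")
    case True
    \<comment> \<open>Here \<open>a\<close> and \<open>b\<close> are both 0, so any prime divides
      them.\<close>
    then show ?thesis using c by (intro exI[of _ 2]) auto
  next
    case False
    then show ?thesis using prime_divisor_exists[of c] c by (meson dvd_trans)
  qed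
qed

text \<open>What the argument takes from the quadratic order: integrality of its elements, two
  generators of \<open>I\<close> over the integers, and no single generator over \<open>R\<close>.
  The ring and module records of the statement return only when matrices act.\<close>

locale nonprincipal_planar_ideal =
  fixes R I :: "'a :: field_char_0 set"
  assumes one_R: "1 \<in> R"
    and add_R: "\<And>x y. x \<in> R \<Longrightarrow> y \<in> R \<Longrightarrow> x + y \<in> R"
    and uminus_R: "\<And>x. x \<in> R \<Longrightarrow> - x \<in> R"
    and mult_R: "\<And>x y. x \<in> R \<Longrightarrow> y \<in> R \<Longrightarrow> x * y \<in> R"
    and integral: "\<And>x. x \<in> R \<Longrightarrow> algebraic_int x"
    and I_sub: "I \<subseteq> R"
    and I_0: "0 \<in> I"
    and I_add: "\<And>x y. x \<in> I \<Longrightarrow> y \<in> I \<Longrightarrow> x + y \<in> I"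
    and I_mult: "\<And>r x. r \<in> R \<Longrightarrow> x \<in> I \<Longrightarrow> r * x \<in> I"
    and planar: "\<exists>e1\<in>I. \<exists>e2\<in>I. \<forall>z\<in>I. \<exists>s t. z = of_int s * e1 + of_int t * e2"
    and nonprincipal: "\<And>d. d \<in> I \<Longrightarrow> \<exists>z\<in>I. \<forall>r\<in>R. z \<noteq> r * d"
begin

section \<open>Subideals and comaximal pairs\<close>

lemma zero_R: "0 \<in> R"
  using add_R[OF one_R uminus_R[OF one_R]] by simp

lemma of_nat_R: "of_nat n \<in> R"
  by (induction n) (auto intro: zero_R add_R one_R)

lemma of_int_R: "of_int n \<in> R"
  using of_nat_R uminus_R[OF of_nat_R] by (cases n rule: int_cases2) auto

text \<open>The submodules of \<open>I\<close> over \<open>R\<close>, written without records.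
  Closure under negation comes from multiplying by -1, which lies in \<open>R\<close>.\<close>

definition subideal :: "'a set \<Rightarrow> bool" where
  "subideal L \<longleftrightarrow> L \<subseteq> I \<and> 0 \<in> L \<and> (\<forall>x\<in>L. \<forall>y\<in>L. x + y \<in> L) \<and> (\<forall>r\<in>R. \<forall>x\<in>L. r * x \<in> L)"

lemma subidealD:
  assumes "subideal L"
  shows "L \<subseteq> I" "0 \<in> L" "\<And>x y. x \<in> L \<Longrightarrow> y \<in> L \<Longrightarrow> x + y \<in> L"
    "\<And>r x. r \<in> R \<Longrightarrow> x \<in> L \<Longrightarrow> r * x \<in> L" "\<And>n x. x \<in> L \<Longrightarrow> of_int n * x \<in> L"
    "\<And>x. x \<in> L \<Longrightarrow> - x \<in> L" "\<And>x y. x \<in> L \<Longrightarrow> y \<in> L \<Longrightarrow> x - y \<in> L"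
proof -
  show 1: "L \<subseteq> I" "0 \<in> L" "\<And>x y. x \<in> L \<Longrightarrow> y \<in> L \<Longrightarrow> x + y \<in> L"
    "\<And>r x. r \<in> R \<Longrightarrow> x \<in> L \<Longrightarrow> r * x \<in> L" using assms by (auto simp: subideal_def)
  then show "\<And>n x. x \<in> L \<Longrightarrow> of_int n * x \<in> L" using of_int_R by blast
  show minus: "- x \<in> L" if "x \<in> L" for x using 1(4)[OF uminus_R[OF one_R] that] by simp
  show "x - y \<in> L" if "x \<in> L" "y \<in> L" for x y
    using 1(3)[OF that(1) minus[OF that(2)]] by simp
qed

lemma subideal_I: "subideal I"
  using I_0 I_add I_mult by (simp add: subideal_def)

lemma subideal_sum:
  assumes "subideal L" "subideal L'"
  shows "subideal {x + y |x y. x \<in> L \<and> y \<in> L'}"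
  unfolding subideal_def
proof (intro conjI ballI)
  note L = subidealD[OF assms(1)] and L' = subidealD[OF assms(2)]
  show "{x + y |x y. x \<in> L \<and> y \<in> L'} \<subseteq> I" using L(1) L'(1) I_add by blast
  show "0 \<in> {x + y |x y. x \<in> L \<and> y \<in> L'}" using L(2) L'(2) by force
  show "u + w \<in> {x + y |x y. x \<in> L \<and> y \<in> L'}"
    if u: "u \<in> {x + y |x y. x \<in> L \<and> y \<in> L'}" and w: "w \<in> {x + y |x y. x \<in> L \<and> y \<in> L'}" for u w
  proof -
    obtain a b where ab: "u = a + b" "a \<in> L" "b \<in> L'" using u by blast
    obtain c d where cd: "w = c + d" "c \<in> L" "d \<in> L'" using w by blast
    have "u + w = (a + c) + (b + d)" by (simp add: ab cd)
    then show ?thesis using ab cd L(3) L'(3) by blast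
  qed
  show "r * u \<in> {x + y |x y. x \<in> L \<and> y \<in> L'}"
    if rR: "r \<in> R" and u: "u \<in> {x + y |x y. x \<in> L \<and> y \<in> L'}" for r u
  proof -
    obtain a b where ab: "u = a + b" "a \<in> L" "b \<in> L'" using u by blast
    then have "r * u = r * a + r * b" by (simp add: distrib_left)
    then show ?thesis using ab rR L(4) L'(4) by blast
  qed
qed

lemma subideal_scaled:
  assumes "subideal L"
  shows "subideal ((\<lambda>x. of_int n * x) ` L)"
  unfolding subideal_def
proof (intro conjI ballI)
  note L = subidealD[OF assms]
  show "(\<lambda>x. of_int n * x) ` L \<subseteq> I" using L(1,5) by blast
  show "0 \<in> (\<lambda>x. of_int n * x) ` L" using L(2) by force
  show "u + w \<in> (\<lambda>x. of_int n * x) ` L"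
    if "u \<in> (\<lambda>x. of_int n * x) ` L" "w \<in> (\<lambda>x. of_int n * x) ` L" for u w
    using that L(3) by (auto simp: distrib_left[symmetric])
  show "r * u \<in> (\<lambda>x. of_int n * x) ` L" if "r \<in> R" "u \<in> (\<lambda>x. of_int n * x) ` L" for r u
    using that L(4) by (auto simp: mult.left_commute[of r])
qed

definition multiples :: "'a \<Rightarrow> 'a set" where
  "multiples c = (\<lambda>r. r * c) ` R"

lemma subideal_multiples:
  assumes "c \<in> I"
  shows "subideal (multiples c)"
  unfolding subideal_def multiples_def
proof (intro conjI ballI)
  show "(\<lambda>r. r * c) ` R \<subseteq> I" using assms I_mult by blast
  show "0 \<in> (\<lambda>r. r * c) ` R" using zero_R by force
  show "u + w \<in> (\<lambda>r. r * c) ` R" if "u \<in> (\<lambda>r. r * c) ` R" "w \<in> (\<lambda>r. r * c) ` R" for u w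
    using that add_R by (auto simp: distrib_right[symmetric])
  show "r * u \<in> (\<lambda>r. r * c) ` R" if "r \<in> R" "u \<in> (\<lambda>r. r * c) ` R" for r u
    using that mult_R by (auto simp: mult.assoc[symmetric])
qed

lemma multiples_self: "c \<in> multiples c"
  unfolding multiples_def using one_R by force

lemma multiples_least: "subideal L \<Longrightarrow> c \<in> L \<Longrightarrow> multiples c \<subseteq> L"
  unfolding multiples_def using subidealD(4) by blast

text \<open>Comaximality relative to \<open>I\<close> instead of the whole ring. For
  \<open>multiples c\<close> and \<open>multiples e\<close> with \<open>c\<close> and
  \<open>e\<close> in \<open>I\<close> it says that the pair generates \<open>I\<close>.\<close>

definition comaximal :: "'a set \<Rightarrow> 'a set \<Rightarrow> bool" where
  "comaximal L L' \<longleftrightarrow> (\<forall>z\<in>I. \<exists>x\<in>L. \<exists>y\<in>L'. z = x + y)"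

lemma comaximal_least:
  assumes "comaximal L L'" "subideal J" "L \<subseteq> J" "L' \<subseteq> J"
  shows "J = I"
proof
  show "J \<subseteq> I" by (rule subidealD(1)[OF assms(2)])
  show "I \<subseteq> J"
  proof
    fix z assume "z \<in> I"
    then obtain x y where "z = x + y" "x \<in> L" "y \<in> L'" using assms(1) by (auto simp: comaximal_def)
    then show "z \<in> J" using assms(3,4) subidealD(3)[OF assms(2), of x y] by auto
  qed
qed

text \<open>The sum of \<open>L\<close> and \<open>L'\<close> is itself a subideal containing both,
  so the hypothesis can be applied to it.\<close>

lemma comaximalI:
  assumes "\<And>J. subideal J \<Longrightarrow> L \<subseteq> J \<Longrightarrow> L' \<subseteq> J \<Longrightarrow> I \<subseteq> J" "subideal L" "subideal L'"
  shows "comaximal L L'"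
proof -
  let ?J = "{x + y |x y. x \<in> L \<and> y \<in> L'}"
  note L = subidealD[OF assms(2)] and L' = subidealD[OF assms(3)]
  have "x \<in> ?J" if "x \<in> L" for x using that L'(2) by (intro CollectI exI[of _ x] exI[of _ 0]) simp
  moreover have "x \<in> ?J" if "x \<in> L'" for x
    using that L(2) by (intro CollectI exI[of _ 0] exI[of _ x]) simp
  ultimately have "I \<subseteq> ?J"
    using assms(1)[OF subideal_sum[OF assms(2,3)]] by blast
  then show ?thesis unfolding comaximal_def by blast
qed

text \<open>The constant term of a monic polynomial of least degree vanishing at \<open>c\<close>.\<close>

lemma int_multiple:
  assumes "c \<in> R" "c \<noteq> 0"
  shows "\<exists>n>0. of_int n \<in> multiples c"
proof -
  obtain p where "poly (map_poly of_int p) c = 0" "lead_coeff p = 1"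
    using integral[OF assms(1)] unfolding algebraic_int_altdef_ipoly by auto
  then have "\<exists>n. n \<noteq> 0 \<and> of_int n \<in> multiples c"
  proof (induction p)
    case (pCons a p)
    have pR: "poly (map_poly of_int q) c \<in> R" for q
      by (induction q) (auto simp: map_poly_pCons intro: zero_R add_R mult_R of_int_R assms)
    have eq: "of_int a + c * poly (map_poly of_int p) c = 0"
      using pCons.prems by (simp add: map_poly_pCons)
    show ?case
    \<comment> \<open>A zero constant term allows division by X, as \<open>c\<close> is nonzero; the
      quotient is still monic and vanishes at \<open>c\<close>. A nonzero constant term is
      \<open>c\<close> times an element of \<open>R\<close>.\<close>
    proof (cases "a = 0")
      case True
      then have "poly (map_poly of_int p) c = 0" using eq assms by simp
      moreover have "lead_coeff p = 1" using pCons.prems True pCons.hyps by (simp split: if_splits)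
      ultimately show ?thesis by (rule pCons.IH)
    next
      case False
      have "of_int a = (- poly (map_poly of_int p) c) * c"
        using eq by (simp add: eq_neg_iff_add_eq_0 mult.commute)
      then have "of_int a \<in> multiples c" unfolding multiples_def using pR uminus_R by blast
      with False show ?thesis by blast
    qed
  qed simp
  then obtain n where n: "n \<noteq> 0" "of_int n \<in> multiples c" by blast
  then obtain r where r: "r \<in> R" "of_int n = r * c" by (auto simp: multiples_def)
  have "of_int (- n) \<in> multiples c"
    unfolding multiples_def using r uminus_R[of r] by (intro image_eqI[of _ _ "- r"]) auto
  with n show ?thesis by (cases "n > 0") (auto intro: exI[of _ n] exI[of _ "- n"])
qed

text \<open>Some positive integer has the form \<open>r * c\<close>, and its product with
  \<open>z\<close> is \<open>(z * r) * c\<close>, where \<open>z * r\<close> is in \<open>R\<close>.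
  So the quotient of \<open>I\<close> by \<open>L\<close> has finite exponent, which leaves only
  finitely many primes to avoid.\<close>

lemma subideal_exponent:
  assumes L: "subideal L" and c: "c \<in> L" "c \<noteq> 0"
  shows "\<exists>n>0. \<forall>z\<in>I. of_int n * z \<in> L"
proof -
  have "c \<in> R" using subidealD(1)[OF L] c I_sub by blast
  then obtain n where n: "n > 0" "of_int n \<in> multiples c" using int_multiple c by blast
  then obtain r where r: "r \<in> R" "of_int n = r * c" by (auto simp: multiples_def)
  have "of_int n * z \<in> L" if "z \<in> I" for z
  proof -
    have eq: "of_int n * z = (z * r) * c" by (simp add: r)
    have "z * r \<in> R" using mult_R that r(1) I_sub by blast
    then show ?thesis unfolding eq using c(1) by (rule subidealD(4)[OF L])
  qed
  with n show ?thesis by blast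
qed

section \<open>Primitive elements and their complements\<close>

lemma I_nonzero: "\<exists>c\<in>I. c \<noteq> 0"
proof -
  obtain z where "z \<in> I" "\<forall>r\<in>R. z \<noteq> r * 0" using nonprincipal[OF I_0] by blast
  then show ?thesis using zero_R by (intro bexI[of _ z]) auto
qed

text \<open>Otherwise division by \<open>p\<close> would preserve \<open>I\<close>. The least
  positive integer in \<open>I\<close>, divided by \<open>p\<close>, would be rational and integral,
  hence a smaller positive integer in \<open>I\<close>.\<close>

lemma scaled_proper:
  assumes "prime p"
  shows "(\<lambda>x. of_int p * x) ` I \<noteq> I"
proof
  assume eq: "(\<lambda>x. of_int p * x) ` I = I"
  obtain c where c: "c \<in> I" "c \<noteq> 0" using I_nonzero by blast
  have "\<exists>n>0. of_int n \<in> I"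
    using int_multiple[of c] c I_sub multiples_least[OF subideal_I c(1)] by blast
  then have "\<exists>n::nat. n > 0 \<and> of_nat n \<in> I"
    by (metis of_int_of_nat_eq pos_int_cases)
  then obtain n :: nat where n: "n > 0" "of_nat n \<in> I"
      "\<And>m. m > 0 \<Longrightarrow> of_nat m \<in> I \<Longrightarrow> n \<le> m"
    using exists_least_iff[of "\<lambda>n. n > 0 \<and> of_nat n \<in> I"] linorder_not_less by blast
  then obtain x where x: "x \<in> I" "of_nat n = of_int p * x" using eq by blast
  have p: "p > 1" using assms by (simp add: prime_gt_1_int)
  have "x = of_nat n / of_int p" using x p by (simp add: field_simps)
  then have "x \<in> \<rat>" by simp
  then have "x \<in> \<int>" using rational_algebraic_int_is_int integral x(1) I_sub by blast
  then obtain m where m: "x = of_int m" by (elim Ints_cases)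
  then have "(of_int (int n) :: 'a) = of_int (p * m)" using x by simp
  then have nm: "int n = p * m" by (simp only: of_int_eq_iff)
  then have "p * m > 0" using n(1) by linarith
  then have "m > 0" using zero_less_mult_pos[of p m] p by linarith
  then have "n \<le> nat m" using n(3)[of "nat m"] x(1) m by (auto simp: of_nat_nat)
  moreover have "m < p * m" using p \<open>m > 0\<close> by simp
  ultimately show False using nm \<open>m > 0\<close> by linarith
qed

definition primitive :: "'a \<Rightarrow> bool" where
  "primitive c \<longleftrightarrow> c \<in> I \<and> (\<exists>d\<in>I. \<forall>z\<in>I. \<exists>s t. z = of_int s * c + of_int t * d)"

lemma primitive_nonzero:
  assumes "primitive c"
  shows "c \<noteq> 0"
proof
  assume "c = 0"
  then obtain d where d: "d \<in> I" "\<forall>z\<in>I. \<exists>t. z = of_int t * d"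
    using assms by (auto simp: primitive_def)
  then show False using nonprincipal[OF d(1)] of_int_R by blast
qed

text \<open>Two rounds of avoidance. The first, inside \<open>I\<close>, treats the primes dividing
  an exponent \<open>m\<close> of the quotient by \<open>L\<close>. The second shifts a coordinate
  by multiples of \<open>m\<close>, which stays within \<open>v + L\<close>, until both coordinates
  are coprime.\<close>

lemma exists_primitive_translate:
  assumes v: "v \<in> I" and L: "subideal L" and com: "comaximal (multiples v) L"
  shows "\<exists>l\<in>L. primitive (v + l)"
proof -
  note Ld = subidealD[OF L]
  obtain e1 e2 where e: "e1 \<in> I" "e2 \<in> I" "\<And>z. z \<in> I \<Longrightarrow> \<exists>s t. z = of_int s * e1 + of_int t * e2"
    using planar by blast
  \<comment> \<open>If \<open>L\<close> were zero, every element of \<open>I\<close> would be a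
    multiple of \<open>v\<close>.\<close>
  have "\<exists>c\<in>L. c \<noteq> 0"
  proof (rule ccontr)
    assume *: "\<not> (\<exists>c\<in>L. c \<noteq> 0)"
    obtain z where z: "z \<in> I" "\<forall>r\<in>R. z \<noteq> r * v" using nonprincipal[OF v] by blast
    then show False using com * by (force simp: comaximal_def multiples_def)
  qed
  then obtain m where m: "m > 0" "\<And>z. z \<in> I \<Longrightarrow> of_int m * z \<in> L"
    using subideal_exponent[OF L] by blast
  define B where "B p = (\<lambda>x. of_int p * x) ` I" for p :: int
  have B: "subideal (B p)" for p unfolding B_def by (rule subideal_scaled) (rule subideal_I)
  have "\<exists>l\<in>L. \<forall>p\<in>prime_factors m. v + l \<notin> B p"
  proof (rule avoid_subgroups)
    fix p assume p: "p \<in> prime_factors m" "v \<in> B p"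
    show "\<exists>l\<in>L. l \<notin> B p"
    proof (rule ccontr)
      assume "\<not> (\<exists>l\<in>L. l \<notin> B p)"
      then have "B p = I" using comaximal_least[OF com B multiples_least[OF B p(2)]] by blast
      then show False using scaled_proper[of p] p(1) by (auto simp: B_def in_prime_factors_iff)
    qed
  next
    fix p x assume "x \<in> L"
    then show "of_int p * x \<in> B p" unfolding B_def using Ld(1) by blast
  qed (use Ld(2,3,5) subidealD(3,5)[OF B] in \<open>auto simp: in_prime_factors_iff\<close>)
  then obtain l0 where l0: "l0 \<in> L" "\<And>p. p \<in> prime_factors m \<Longrightarrow> v + l0 \<notin> B p" by blast
  have "v + l0 \<in> I" using v l0(1) Ld(1) I_add by blast
  then obtain x y' where xy': "v + l0 = of_int x * e1 + of_int y' * e2" using e(3) by blast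
  \<comment> \<open>The value \<open>m\<close> in place of a vanishing coordinate keeps
    \<open>y\<close> nonzero, so that its prime factors describe all primes dividing it; the change
    by \<open>m * e2\<close> lies in \<open>L\<close>.\<close>
  define y where "y = (if y' = 0 then m else y')"
  have y: "y \<noteq> 0" "y' = 0 \<Longrightarrow> y = m" "y' \<noteq> 0 \<Longrightarrow> y = y'" using m(1) by (auto simp: y_def)
  have xy: "\<not> p dvd x" if p: "prime p" "p dvd m" "p dvd y" for p
  proof
    assume "p dvd x"
    moreover have "p dvd y'" using p y(2,3) by (cases "y' = 0") auto
    ultimately obtain a b where ab: "x = p * a" "y' = p * b" by (elim dvdE)
    have "v + l0 = of_int p * (of_int a * e1 + of_int b * e2)"
      unfolding xy' ab by (simp add: algebra_simps)
    moreover have "of_int a * e1 + of_int b * e2 \<in> I" using e I_add I_mult of_int_R by blast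
    ultimately have "v + l0 \<in> B p" unfolding B_def by blast
    then show False using l0(2)[of p] p m(1) by (simp add: in_prime_factors_iff)
  qed
  \<comment> \<open>A prime factor of \<open>y\<close> that divides \<open>x\<close> does not divide
    \<open>m\<close>, so adding multiples of \<open>m\<close> to \<open>x\<close> can avoid
    it.\<close>
  have "\<exists>l\<in>range ((*) m). \<forall>p\<in>prime_factors y. x + l \<notin> {z. p dvd z}"
  proof (rule avoid_subgroups)
    fix p assume p: "p \<in> prime_factors y" "x \<in> {z. p dvd z}"
    then have "m \<notin> {z. p dvd z}" using xy[of p] by (auto simp: in_prime_factors_iff)
    then show "\<exists>l\<in>range ((*) m). l \<notin> {z. p dvd z}" by (intro bexI[of _ m]) (auto intro: range_eqI[of _ _ 1])
  next
    fix x y assume "x \<in> range ((*) m)" "y \<in> range ((*) m)"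
    then show "x + y \<in> range ((*) m)" by (auto simp: distrib_left[symmetric])
  next
    fix x n assume "x \<in> range ((*) m)"
    then show "of_int n * x \<in> range ((*) m)" by (auto simp: mult.left_commute[of n])
  qed (auto simp: in_prime_factors_iff intro: range_eqI[of _ _ 0])
  then obtain s where s: "\<And>p. p \<in> prime_factors y \<Longrightarrow> \<not> p dvd x + m * s" by blast
  define l where "l = l0 + of_int m * (of_int s * e1) + of_int (y - y') * e2"
  have "of_int (y - y') * e2 \<in> L"
    using m(2)[OF e(2)] Ld(2) y(2,3) by (cases "y' = 0") auto
  moreover have "of_int m * (of_int s * e1) \<in> L" using m(2) I_mult of_int_R e by blast
  ultimately have lL: "l \<in> L" unfolding l_def using l0(1) Ld(3) by blast
  have vl: "v + l = of_int (x + m * s) * e1 + of_int y * e2"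
    unfolding l_def add.assoc[symmetric] xy' by (simp add: algebra_simps)
  have "coprime (x + m * s) y"
  proof (rule ccontr)
    assume "\<not> coprime (x + m * s) y"
    then obtain p where "prime p" "p dvd x + m * s" "p dvd y"
      using not_coprime_int_prime by blast
    then show False using s y(1) by (auto simp: in_prime_factors_iff)
  qed
  then obtain a b where ab: "a * (x + m * s) + b * y = 1"
    using bezout_int[of "x + m * s" y] by auto
  \<comment> \<open>The Bezout coefficients complete the row \<open>(x + m * s, y)\<close> by the
    row \<open>(- b, a)\<close> to a matrix of determinant 1, so \<open>v + l\<close> and
    \<open>d\<close> span the same group as \<open>e1\<close> and \<open>e2\<close>.\<close>
  define d where "d = of_int a * e2 - of_int b * e1"
  have "\<exists>s' t. z = of_int s' * (v + l) + of_int t * d" if z: "z \<in> I" for z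
  proof -
    obtain f g where fg: "z = of_int f * e1 + of_int g * e2" using e(3)[OF z] by blast
    define x1 where "x1 = x + m * s"
    have "z = of_int ((a * x1 + b * y) * f) * e1 + of_int ((a * x1 + b * y) * g) * e2"
      using ab by (simp add: fg x1_def)
    also have "\<dots> = of_int (a * f + b * g) * (v + l) + of_int (x1 * g - y * f) * d"
      unfolding vl x1_def[symmetric] d_def by (simp add: algebra_simps)
    finally show ?thesis by blast
  qed
  moreover have "d \<in> I" unfolding d_def by (intro subidealD(5,7)[OF subideal_I] e)
  moreover have "v + l \<in> I" using v lL Ld(1) I_add by blast
  ultimately have "primitive (v + l)" unfolding primitive_def by blast
  with lL show ?thesis by blast
qed

text \<open>Since \<open>c\<close> is part of a basis \<open>(c, d)\<close> of \<open>I\<close> over the integers, the quotient of \<open>I\<close> by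
  \<open>R c\<close> is a finite cyclic group generated by \<open>d\<close>; the number \<open>n\<close> in the proof is its order.\<close>

lemma exists_complement:
  assumes c: "primitive c" and a: "a \<in> I" and L: "subideal L"
    and gen: "\<And>J. subideal J \<Longrightarrow> a \<in> J \<Longrightarrow> c \<in> J \<Longrightarrow> L \<subseteq> J \<Longrightarrow> J = I"
  shows "\<exists>l\<in>L. comaximal (multiples (a + l)) (multiples c)"
proof -
  note Ld = subidealD[OF L]
  obtain d where cI: "c \<in> I" and d: "d \<in> I" "\<And>z. z \<in> I \<Longrightarrow> \<exists>s t. z = of_int s * c + of_int t * d"
    using c by (auto simp: primitive_def)
  note C = subideal_multiples[OF cI]
  note Cd = subidealD[OF C]
  \<comment> \<open>The annihilator of the class of \<open>d\<close> modulo
    \<open>multiples c\<close>. It is nonzero because \<open>c\<close> is.\<close>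
  define S where "S = {n. of_int n * d \<in> multiples c}"
  have "\<exists>n\<in>S. \<forall>x\<in>S. n dvd x"
    by (rule int_subgroup_cyclic) (auto simp: S_def Cd(2) left_diff_distrib intro: Cd(7))
  then obtain n where n: "n \<in> S" "\<And>x. x \<in> S \<Longrightarrow> n dvd x" by blast
  have n0: "n \<noteq> 0"
  proof
    assume "n = 0"
    obtain m where "m > 0" "\<forall>z\<in>I. of_int m * z \<in> multiples c"
      using subideal_exponent[OF C multiples_self primitive_nonzero[OF c]] by blast
    then have "m \<in> S" using d by (simp add: S_def)
    then show False using n(2)[of m] \<open>n = 0\<close> \<open>m > 0\<close> by auto
  qed
  \<comment> \<open>The preimage in \<open>I\<close> of \<open>p\<close> times the cyclic quotient.
    An element outside \<open>B p\<close> for every prime \<open>p\<close> dividing \<open>n\<close>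
    maps to a generator.\<close>
  define B where "B p = {x + y |x y. x \<in> (\<lambda>x. of_int p * x) ` I \<and> y \<in> multiples c}" for p :: int
  have B: "subideal (B p)" for p
    unfolding B_def by (intro subideal_sum subideal_scaled subideal_I C)
  have B1: "of_int p * z \<in> B p" if "z \<in> I" for p z
    unfolding B_def using that Cd(2) by (intro CollectI exI[of _ "of_int p * z"] exI[of _ 0]) auto
  have B2: "z \<in> B p" if "z \<in> multiples c" for p z
    unfolding B_def using that I_0 by (intro CollectI exI[of _ 0] exI[of _ z]) (auto intro: image_eqI[of _ _ 0])
  have "\<exists>l\<in>L. \<forall>p\<in>prime_factors n. a + l \<notin> B p"
  proof (rule avoid_subgroups)
    fix p assume p: "p \<in> prime_factors n" "a \<in> B p"
    show "\<exists>l\<in>L. l \<notin> B p"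
    proof (rule ccontr)
      assume "\<not> (\<exists>l\<in>L. l \<notin> B p)"
      then have "B p = I" using gen[OF B p(2) B2[OF multiples_self]] by blast
      then have "d \<in> B p" using d by simp
      then obtain z y where zy: "z \<in> I" "y \<in> multiples c" "d = of_int p * z + y"
        by (auto simp: B_def)
      obtain s t where st: "z = of_int s * c + of_int t * d" using d(2)[OF zy(1)] by blast
      \<comment> \<open>Modulo \<open>multiples c\<close> the element \<open>z\<close> equals
        \<open>t * d\<close>, so \<open>1 - p * t\<close> kills the class of \<open>d\<close> and is
        divisible by \<open>n\<close>, hence by \<open>p\<close>.\<close>
      have "of_int (1 - p * t) * d = d - of_int p * (of_int t * d)"
        by (simp add: left_diff_distrib)
      also have "\<dots> = (of_int p * z + y) - of_int p * (z - of_int s * c)"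
        using zy(3) st by simp
      also have "\<dots> = of_int (p * s) * c + y" by (simp add: algebra_simps)
      finally have eq: "of_int (1 - p * t) * d = of_int (p * s) * c + y" .
      have "of_int (1 - p * t) * d \<in> multiples c"
        unfolding eq by (intro Cd(3) Cd(5) multiples_self zy(2))
      then have "n dvd 1 - p * t" using n(2) by (simp add: S_def)
      then have "p dvd 1 - p * t" using p(1) by (auto simp: in_prime_factors_iff)
      then have "p dvd (1 - p * t) + p * t" by (intro dvd_add) auto
      then show False using p(1) by (auto simp: in_prime_factors_iff)
    qed
  next
    fix p x assume "x \<in> L"
    then show "of_int p * x \<in> B p" using B1 Ld(1) by blast
  qed (use Ld(2,3,5) subidealD(3,5)[OF B] in \<open>auto simp: in_prime_factors_iff\<close>)
  then obtain l where l: "l \<in> L" "\<And>p. p \<in> prime_factors n \<Longrightarrow> a + l \<notin> B p" by blast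
  have alI: "a + l \<in> I" using a l(1) Ld(1) I_add by blast
  obtain s u where su: "a + l = of_int s * c + of_int u * d" using d(2)[OF alI] by blast
  have "coprime u n"
  proof (rule ccontr)
    assume "\<not> coprime u n"
    then obtain p where p: "prime p" "p dvd u" "p dvd n" using not_coprime_int_prime by blast
    then obtain u' where "u = p * u'" by (elim dvdE)
    then have "a + l = of_int p * (of_int u' * d) + of_int s * c" by (simp add: su)
    moreover have "of_int p * (of_int u' * d) \<in> B p" using B1 d(1) I_mult of_int_R by blast
    moreover have "of_int s * c \<in> B p" using B2 Cd(5) multiples_self by blast
    ultimately have "a + l \<in> B p" using subidealD(3)[OF B] by simp
    then show False using l(2)[of p] p n0 by (auto simp: in_prime_factors_iff)
  qed
  then obtain f g where fg: "f * u + g * n = 1" using bezout_int[of u n] by auto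
  have "comaximal (multiples (a + l)) (multiples c)"
  proof (rule comaximalI)
    fix J assume J: "subideal J" "multiples (a + l) \<subseteq> J" "multiples c \<subseteq> J"
    note Jd = subidealD[OF J(1)]
    have cJ: "c \<in> J" "a + l \<in> J" using J multiples_self by auto
    \<comment> \<open>\<open>J\<close> contains \<open>u * d\<close> and \<open>n * d\<close>; as
      \<open>u\<close> and \<open>n\<close> are coprime, it contains \<open>d\<close>.\<close>
    have "of_int f * ((a + l) - of_int s * c) \<in> J" by (intro Jd(5,7) cJ)
    moreover have "of_int n * d \<in> J" using n(1) J(3) by (auto simp: S_def)
    then have "of_int g * (of_int n * d) \<in> J" by (rule Jd(5))
    moreover have "of_int f * ((a + l) - of_int s * c) + of_int g * (of_int n * d) =
        of_int (f * u + g * n) * d"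
      by (simp add: su algebra_simps)
    ultimately have "of_int (f * u + g * n) * d \<in> J" using Jd(3) by metis
    then have "d \<in> J" using fg by simp
    then show "I \<subseteq> J" using d(2) Jd(3,5) cJ by (metis subsetI)
  qed (use alI C in \<open>auto intro: subideal_multiples\<close>)
  with l show ?thesis by blast
qed

end

section \<open>Elementary equivalence of generating tuples\<close>

context nonprincipal_planar_ideal
begin

section \<open>Spans of entries and elementary operations\<close>

lemma comaximal_sym: "comaximal L L' \<Longrightarrow> comaximal L' L"
  unfolding comaximal_def by (metis add.commute)

text \<open>Spans are indexed by a set of positions, so that single entries can be left out.\<close>

definition lincombs :: "(nat \<Rightarrow> 'a) \<Rightarrow> nat set \<Rightarrow> 'a set" where
  "lincombs v S = {\<Sum>i\<in>S. r i * v i |r. r \<in> S \<rightarrow> R}"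

lemma lincombsI: "r \<in> S \<rightarrow> R \<Longrightarrow> (\<Sum>i\<in>S. r i * v i) \<in> lincombs v S"
  unfolding lincombs_def by blast

lemma lincombs_cong: "(\<And>i. i \<in> S \<Longrightarrow> v i = w i) \<Longrightarrow> lincombs v S = lincombs w S"
  unfolding lincombs_def by (simp cong: sum.cong)

lemma lincombs_least:
  assumes "subideal J" "\<And>i. i \<in> S \<Longrightarrow> v i \<in> J"
  shows "lincombs v S \<subseteq> J"
proof -
  have "(\<Sum>i\<in>S. r i * v i) \<in> J" if "r \<in> S \<rightarrow> R" for r
    using that assms(2)
    by (induction S rule: infinite_finite_induct)
      (auto intro!: subidealD(2,3,4)[OF assms(1)])
  then show ?thesis by (auto simp: lincombs_def)
qed

lemma lincombs_base:
  assumes "finite S" "i \<in> S"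
  shows "v i \<in> lincombs v S"
proof -
  have "(\<Sum>j\<in>S. (if j = i then 1 else 0) * v j) = v i"
    using assms by (simp add: if_distrib[of "\<lambda>x. x * _"] cong: if_cong)
  moreover have "(\<lambda>j. if j = i then 1 else 0) \<in> S \<rightarrow> R" using one_R zero_R by auto
  ultimately show ?thesis using lincombsI by metis
qed

lemma subideal_lincombs:
  assumes "\<And>i. i \<in> S \<Longrightarrow> v i \<in> I"
  shows "subideal (lincombs v S)"
  unfolding subideal_def
proof (intro conjI ballI)
  show "lincombs v S \<subseteq> I" by (rule lincombs_least[OF subideal_I assms])
  show "0 \<in> lincombs v S" using lincombsI[of "\<lambda>_. 0" S v] zero_R by simp
  show "x + y \<in> lincombs v S" if xy: "x \<in> lincombs v S" "y \<in> lincombs v S" for x y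
  proof -
    obtain r r' where r: "r \<in> S \<rightarrow> R" "x = (\<Sum>i\<in>S. r i * v i)"
        "r' \<in> S \<rightarrow> R" "y = (\<Sum>i\<in>S. r' i * v i)"
      using xy by (auto simp: lincombs_def)
    then have "x + y = (\<Sum>i\<in>S. (r i + r' i) * v i)"
      by (simp add: distrib_right sum.distrib)
    moreover have "(\<lambda>i. r i + r' i) \<in> S \<rightarrow> R" using r add_R by auto
    ultimately show ?thesis using lincombsI by metis
  qed
  show "a * x \<in> lincombs v S" if a: "a \<in> R" and x: "x \<in> lincombs v S" for a x
  proof -
    obtain r where r: "r \<in> S \<rightarrow> R" "x = (\<Sum>i\<in>S. r i * v i)"
      using x by (auto simp: lincombs_def)
    then have "a * x = (\<Sum>i\<in>S. (a * r i) * v i)"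
      by (simp add: sum_distrib_left mult.assoc)
    moreover have "(\<lambda>i. a * r i) \<in> S \<rightarrow> R" using r a mult_R by auto
    ultimately show ?thesis using lincombsI by metis
  qed
qed

definition tuple :: "nat \<Rightarrow> (nat \<Rightarrow> 'a) \<Rightarrow> bool" where
  "tuple k v \<longleftrightarrow> v \<in> {..<k} \<rightarrow>\<^sub>E I"

definition generating :: "nat \<Rightarrow> (nat \<Rightarrow> 'a) \<Rightarrow> bool" where
  "generating k v \<longleftrightarrow> tuple k v \<and> lincombs v {..<k} = I"

lemma tupleD: "tuple k v \<Longrightarrow> i < k \<Longrightarrow> v i \<in> I"
  by (auto simp: tuple_def)

lemma tuple_upd: "tuple k v \<Longrightarrow> j < k \<Longrightarrow> x \<in> I \<Longrightarrow> tuple k (v(j := x))"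
  by (auto simp: tuple_def PiE_def extensional_def)

lemma generatingD:
  assumes "generating k v" "subideal J" "\<And>i. i < k \<Longrightarrow> v i \<in> J"
  shows "J = I"
  using assms lincombs_least[OF assms(2), of "{..<k}" v] subidealD(1)[OF assms(2)]
  by (auto simp: generating_def)

text \<open>A step amounts to an invertible matrix that differs from the identity only in column
  \<open>j\<close>. Leaving entry \<open>j\<close> out of the span makes the step reversible;
  symmetry is not built in but proved in \<open>elem_sym\<close>.\<close>

inductive elem_equiv :: "nat \<Rightarrow> (nat \<Rightarrow> 'a) \<Rightarrow> (nat \<Rightarrow> 'a) \<Rightarrow> bool" for k where
  elem_refl: "elem_equiv k v v"
| elem_step: "elem_equiv k v w \<Longrightarrow> j < k \<Longrightarrow> z \<in> lincombs w ({..<k} - {j}) \<Longrightarrow>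
    elem_equiv k v (w(j := w j + z))"

lemma elem_trans[trans]:
  assumes "elem_equiv k u v" "elem_equiv k v w"
  shows "elem_equiv k u w"
  using assms(2,1) by (induction rule: elem_equiv.induct) (auto intro: elem_equiv.intros)

lemma lincombs_subset_I: "tuple k v \<Longrightarrow> S \<subseteq> {..<k} \<Longrightarrow> lincombs v S \<subseteq> I"
  by (rule lincombs_least[OF subideal_I]) (auto intro: tupleD)

lemma elem_equiv_tuple:
  assumes "elem_equiv k v w" "tuple k v"
  shows "tuple k w"
  using assms
proof (induction rule: elem_equiv.induct)
  case (elem_step v w j z)
  then have "tuple k w" by simp
  moreover have "w j + z \<in> I"
    using lincombs_subset_I[OF \<open>tuple k w\<close>, of "{..<k} - {j}"] elem_step tupleD[OF \<open>tuple k w\<close>]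
    by (intro I_add) auto
  ultimately show ?case using elem_step by (intro tuple_upd)
qed

text \<open>Changing entry \<open>j\<close> does not affect the span of the others, so
  \<open>- z\<close> is available for undoing a step.\<close>

lemma elem_sym:
  assumes "elem_equiv k v w" "tuple k v"
  shows "elem_equiv k w v"
  using assms
proof (induction rule: elem_equiv.induct)
  case (elem_step v w j z)
  let ?w = "w(j := w j + z)"
  have w: "tuple k w" using elem_equiv_tuple elem_step by blast
  have sub: "subideal (lincombs w ({..<k} - {j}))"
    by (rule subideal_lincombs) (auto intro: tupleD[OF w])
  have "- z \<in> lincombs w ({..<k} - {j})"
    using subidealD(6)[OF sub] elem_step by blast
  also have "lincombs w ({..<k} - {j}) = lincombs ?w ({..<k} - {j})"
    by (rule lincombs_cong) auto
  finally have "elem_equiv k ?w (?w(j := ?w j + - z))"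
    using elem_step by (intro elem_equiv.intros)
  then have "elem_equiv k ?w w" by simp
  then show ?case using elem_trans elem_step by blast
qed (rule elem_refl)

text \<open>The old entry \<open>j\<close> is the new one minus \<open>z\<close>, and
  \<open>z\<close> is a combination of entries that did not change.\<close>

lemma elem_equiv_generating:
  assumes "elem_equiv k v w" "generating k v"
  shows "generating k w"
  using assms
proof (induction rule: elem_equiv.induct)
  case (elem_step v w j z)
  let ?w = "w(j := w j + z)"
  have w: "generating k w" using elem_step by simp
  have t: "tuple k ?w"
    using elem_equiv_tuple[OF elem_equiv.elem_step[OF elem_refl elem_step.hyps(2,3)]] w
    by (simp add: generating_def)
  have sub: "subideal (lincombs ?w {..<k})"
    by (rule subideal_lincombs) (use tupleD[OF t] in simp)
  have "z \<in> lincombs ?w ({..<k} - {j})"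
    using elem_step.hyps(3) lincombs_cong[of "{..<k} - {j}" ?w w] by simp
  also have "lincombs ?w ({..<k} - {j}) \<subseteq> lincombs ?w {..<k}"
    by (intro lincombs_least sub lincombs_base) auto
  finally have z: "z \<in> lincombs ?w {..<k}" .
  have base: "?w i \<in> lincombs ?w {..<k}" if "i < k" for i
    using that by (intro lincombs_base) auto
  have "w i \<in> lincombs ?w {..<k}" if "i < k" for i
    using base[OF that] subidealD(7)[OF sub base[OF that] z] by (cases "i = j") auto
  then have "lincombs ?w {..<k} = I" by (rule generatingD[OF w sub])
  with t show ?case unfolding generating_def by blast
qed

text \<open>Two entries that generate \<open>I\<close> put the difference \<open>x - w j\<close>
  into the span of the positions other than \<open>j\<close>, so a single step suffices.\<close>

lemma elem_replace:
  assumes w: "tuple k w" and ij: "i < k" "i' < k" "j < k" "i \<noteq> j" "i' \<noteq> j"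
    and com: "comaximal (multiples (w i)) (multiples (w i'))" and x: "x \<in> I"
  shows "elem_equiv k w (w(j := x))"
proof -
  have sub: "subideal (lincombs w ({..<k} - {j}))"
    by (rule subideal_lincombs) (auto intro: tupleD[OF w])
  have "multiples (w i) \<subseteq> lincombs w ({..<k} - {j})"
    using ij by (intro multiples_least sub lincombs_base) auto
  moreover have "multiples (w i') \<subseteq> lincombs w ({..<k} - {j})"
    using ij by (intro multiples_least sub lincombs_base) auto
  ultimately have "lincombs w ({..<k} - {j}) = I" by (rule comaximal_least[OF com sub])
  moreover have "x - w j \<in> I" using subidealD(7)[OF subideal_I x] tupleD[OF w] ij by blast
  ultimately have "elem_equiv k w (w(j := w j + (x - w j)))"
    using ij by (intro elem_equiv.intros) auto
  then show ?thesis by simp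
qed

section \<open>Reduction to tuples supported on two positions\<close>

definition triple :: "nat \<Rightarrow> 'a \<Rightarrow> 'a \<Rightarrow> 'a \<Rightarrow> nat \<Rightarrow> 'a" where
  "triple k x y z = (\<lambda>i\<in>{..<k}. if i = 0 then x else if i = 1 then y else if i = 2 then z else 0)"

lemma tuple_triple: "x \<in> I \<Longrightarrow> y \<in> I \<Longrightarrow> z \<in> I \<Longrightarrow> tuple k (triple k x y z)"
  using I_0 by (auto simp: tuple_def triple_def)

lemma triple_nth:
  assumes "k > 2"
  shows "triple k x y z 0 = x" "triple k x y z 1 = y" "triple k x y z 2 = z"
  using assms by (auto simp: triple_def)

lemma triple_upd:
  assumes "k > 2"
  shows "(triple k x y z)(0 := u) = triple k u y z" "(triple k x y z)(1 := u) = triple k x u z"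
    "(triple k x y z)(2 := u) = triple k x y u"
  using assms by (auto simp: triple_def fun_eq_iff restrict_def)

text \<open>Position 0 is made primitive with the help of all the others, position 1 then completes
  it with the help of the positions from 2 on, and once these two generate \<open>I\<close> the rest
  can be set to 0.\<close>

lemma reduce_to_pair:
  assumes k: "k > 2" and v: "generating k v"
  shows "\<exists>c e. primitive c \<and> e \<in> I \<and> comaximal (multiples c) (multiples e) \<and>
    elem_equiv k v (triple k c e 0)"
proof -
  have tv: "tuple k v" using v by (simp add: generating_def)
  let ?L = "lincombs v ({..<k} - {0})"
  have L: "subideal ?L" by (rule subideal_lincombs) (auto intro: tupleD[OF tv])
  have v0: "v 0 \<in> I" using tupleD[OF tv] k by simp
  have "comaximal (multiples (v 0)) ?L"
  proof (rule comaximalI)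
    fix J assume J: "subideal J" "multiples (v 0) \<subseteq> J" "?L \<subseteq> J"
    have "v i \<in> J" if "i < k" for i
      using J multiples_self[of "v 0"] lincombs_base[of "{..<k} - {0}" i v] that
      by (cases "i = 0") auto
    then show "I \<subseteq> J" using generatingD[OF v J(1)] by blast
  qed (use L subideal_multiples[OF v0] in auto)
  from exists_primitive_translate[OF v0 L this]
  obtain l where l: "l \<in> ?L" "primitive (v 0 + l)" by blast
  define c where "c = v 0 + l"
  define v1 where "v1 = v(0 := c)"
  have c: "primitive c" "c \<in> I" using l by (auto simp: c_def primitive_def)
  have e1: "elem_equiv k v v1"
    unfolding v1_def c_def using k l by (intro elem_equiv.intros) auto
  have g1: "generating k v1" by (rule elem_equiv_generating[OF e1 v])
  then have t1: "tuple k v1" by (simp add: generating_def)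
  let ?L' = "lincombs v1 ({..<k} - {0, 1})"
  have L': "subideal ?L'" by (rule subideal_lincombs) (auto intro: tupleD[OF t1])
  have "\<exists>l\<in>?L'. comaximal (multiples (v1 1 + l)) (multiples c)"
  proof (rule exists_complement[OF c(1) _ L'])
    show "v1 1 \<in> I" using tupleD[OF t1] k by simp
    fix J assume J: "subideal J" "v1 1 \<in> J" "c \<in> J" "?L' \<subseteq> J"
    have "v1 i \<in> J" if "i < k" for i
    proof -
      have "i = 0 \<or> i = 1 \<or> i \<in> {..<k} - {0, 1}" using that by auto
      then show ?thesis using J lincombs_base[of "{..<k} - {0, 1}" i v1] by (auto simp: v1_def)
    qed
    then show "J = I" using generatingD[OF g1 J(1)] by blast
  qed
  then obtain l' where l': "l' \<in> ?L'" "comaximal (multiples (v1 1 + l')) (multiples c)" by blast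
  define e where "e = v1 1 + l'"
  define v2 where "v2 = v1(1 := e)"
  have "?L' \<subseteq> lincombs v1 ({..<k} - {1})"
    by (intro lincombs_least subideal_lincombs lincombs_base) (auto intro: tupleD[OF t1])
  then have e2: "elem_equiv k v1 v2"
    unfolding v2_def e_def using k l' by (intro elem_equiv.intros) auto
  have t2: "tuple k v2" by (rule elem_equiv_tuple[OF e2 t1])
  have v2: "v2 0 = c" "v2 1 = e" by (auto simp: v1_def v2_def)
  have eI: "e \<in> I" using tupleD[OF t2, of 1] k v2 by simp
  have com: "comaximal (multiples c) (multiples e)"
    using comaximal_sym l' by (simp add: e_def)
  \<comment> \<open>The positions from 2 to \<open>m - 1\<close> are cleared one at a time; for
    \<open>m\<close> at most 2 nothing changes.\<close>
  have "elem_equiv k v2 (\<lambda>i. if 2 \<le> i \<and> i < m then 0 else v2 i)" if "m \<le> k" for m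
    using that
  proof (induction m)
    case 0
    then show ?case by (simp add: elem_refl)
  next
    case (Suc m)
    let ?u = "\<lambda>i. if 2 \<le> i \<and> i < m then 0 else v2 i"
    have u: "elem_equiv k v2 ?u" using Suc by simp
    show ?case
    proof (cases "2 \<le> m")
      case True
      have "elem_equiv k ?u (?u(m := 0))"
        by (rule elem_replace[of _ _ 0 1])
          (use elem_equiv_tuple[OF u t2] com v2 True Suc.prems I_0 k in auto)
      also have "?u(m := 0) = (\<lambda>i. if 2 \<le> i \<and> i < Suc m then 0 else v2 i)"
        using True by (auto simp: fun_eq_iff less_Suc_eq)
      finally show ?thesis using elem_trans u by blast
    next
      case False
      then have "(\<lambda>i. if 2 \<le> i \<and> i < Suc m then 0 else v2 i) = v2"
        by (auto simp: fun_eq_iff)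
      then show ?thesis by (simp add: elem_refl)
    qed
  qed
  from this[of k] have "elem_equiv k v2 (\<lambda>i. if 2 \<le> i \<and> i < k then 0 else v2 i)" by simp
  also have "(\<lambda>i. if 2 \<le> i \<and> i < k then 0 else v2 i) = triple k c e 0"
  proof
    fix i show "(if 2 \<le> i \<and> i < k then 0 else v2 i) = triple k c e 0 i"
      using t2 v2 k by (cases "i = 0 \<or> i = 1")
        (auto simp: triple_def tuple_def PiE_def extensional_def)
  qed
  finally have "elem_equiv k v (triple k c e 0)" using elem_trans e1 e2 by blast
  with c eI com show ?thesis by blast
qed

text \<open>One position changes at a time: \<open>(c, e, 0)\<close>, \<open>(c, e, c')\<close>,
  \<open>(c, f, c')\<close>, \<open>(c', f, c')\<close>, \<open>(c', f, e')\<close>,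
  \<open>(c', e', e')\<close>, \<open>(c', e', 0)\<close>, where \<open>f\<close> stands for
  \<open>e + l\<close>. It generates \<open>I\<close> together with \<open>c'\<close>, and it
  differs from \<open>e\<close> by a multiple of the entry \<open>c\<close> in position 0.\<close>

lemma pairs_equivalent:
  assumes k: "k > 2" and c: "primitive c" "e \<in> I" "comaximal (multiples c) (multiples e)"
    and c': "primitive c'" "e' \<in> I" "comaximal (multiples c') (multiples e')"
  shows "elem_equiv k (triple k c e 0) (triple k c' e' 0)"
proof -
  have cI: "c \<in> I" "c' \<in> I" using c c' by (auto simp: primitive_def)
  note C = subideal_multiples[OF cI(1)]
  note tt = tuple_triple triple_nth[OF k] triple_upd[OF k]
    triple_nth[OF k, simplified] triple_upd[OF k, simplified] I_0 cI c c'
  have "\<exists>l\<in>multiples c. comaximal (multiples (e + l)) (multiples c')"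
  proof (rule exists_complement[OF c'(1) c(2) C])
    fix J assume "subideal J" "e \<in> J" "multiples c \<subseteq> J"
    then show "J = I" using comaximal_least[OF c(3)] multiples_least by blast
  qed
  then obtain l where l: "l \<in> multiples c" "comaximal (multiples (e + l)) (multiples c')" by blast
  have fI: "e + l \<in> I" using c(2) l(1) subidealD(1)[OF C] I_add by blast
  have "elem_equiv k (triple k c e 0) (triple k c e c')"
    using elem_replace[of k "triple k c e 0" 0 1 2 c'] k by (simp add: tt)
  also have "elem_equiv k (triple k c e c') (triple k c (e + l) c')"
  proof -
    have "c \<in> lincombs (triple k c e c') ({..<k} - {1})"
      using lincombs_base[of "{..<k} - {1}" 0 "triple k c e c'"] k by (simp add: tt)
    moreover have "subideal (lincombs (triple k c e c') ({..<k} - {1}))"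
      by (rule subideal_lincombs) (auto intro!: tupleD[OF tuple_triple] simp: tt)
    ultimately have "l \<in> lincombs (triple k c e c') ({..<k} - {1})"
      using l multiples_least by blast
    then show ?thesis
      using elem_step[OF elem_refl, of 1 k l "triple k c e c'"] k by (simp add: tt)
  qed
  \<comment> \<open>Positions 1 and 2 now hold a generating pair, which frees position 0.\<close>
  also have "elem_equiv k (triple k c (e + l) c') (triple k c' (e + l) c')"
    using elem_replace[of k "triple k c (e + l) c'" 1 2 0 c'] k l fI by (simp add: tt)
  also have "elem_equiv k (triple k c' (e + l) c') (triple k c' (e + l) e')"
    using elem_replace[of k "triple k c' (e + l) c'" 0 1 2 e'] k l fI by (simp add: tt comaximal_sym)
  also have "elem_equiv k (triple k c' (e + l) e') (triple k c' e' e')"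
    using elem_replace[of k "triple k c' (e + l) e'" 0 2 1 e'] k l fI by (simp add: tt)
  also have "elem_equiv k (triple k c' e' e') (triple k c' e' 0)"
    using elem_replace[of k "triple k c' e' e'" 0 1 2 0] k l fI by (simp add: tt)
  finally show ?thesis .
qed

lemma generating_elem_equiv:
  assumes "k > 2" "generating k v" "generating k w"
  shows "elem_equiv k v w"
proof -
  obtain c e where c: "primitive c" "e \<in> I" "comaximal (multiples c) (multiples e)"
    "elem_equiv k v (triple k c e 0)" using reduce_to_pair[OF assms(1,2)] by blast
  obtain c' e' where c': "primitive c'" "e' \<in> I" "comaximal (multiples c') (multiples e')"
    "elem_equiv k w (triple k c' e' 0)" using reduce_to_pair[OF assms(1,3)] by blast
  have "elem_equiv k (triple k c' e' 0) w"
    using elem_sym[OF c'(4)] assms(3) by (simp add: generating_def)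
  then show ?thesis
    using elem_trans pairs_equivalent[OF assms(1) c(1-3) c'(1-3)] c(4) by blast
qed

end

section \<open>Matrices over the order\<close>

lemma type_algebra_simps:
  "carrier ring_of_type_algebra = UNIV" "monoid.mult ring_of_type_algebra = (*)"
  "one ring_of_type_algebra = 1" "zero ring_of_type_algebra = 0" "add ring_of_type_algebra = (+)"
  by (simp_all add: ring_of_type_algebra_def)

text \<open>Phrased through zero, addition and carrier alone, so that it serves both the ring
  \<open>ring_on R\<close> and the record \<open>ideal_module\<close>.\<close>

lemma finsum_eq_sum:
  fixes G :: "('a :: comm_monoid_add, 'b) ring_scheme"
  assumes G: "zero G = 0" "add G = (+)" "0 \<in> carrier G"
    "\<And>x y. x \<in> carrier G \<Longrightarrow> y \<in> carrier G \<Longrightarrow> x + y \<in> carrier G"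
    and f: "finite A" "f \<in> A \<rightarrow> carrier G"
  shows "finsum G f A = sum f A"
proof -
  interpret abelian_monoid G
    by (rule abelian_monoidI) (use G in \<open>auto simp: add_ac\<close>)
  show ?thesis using f
    by (induction A rule: finite_induct) (auto simp: G)
qed

context nonprincipal_planar_ideal
begin

section \<open>The monoid of matrices over the order\<close>

abbreviation matrices :: "nat \<Rightarrow> (nat \<times> nat \<Rightarrow> 'a) monoid" where
  "matrices k \<equiv> matrix_monoid (ring_on R) k"

lemma matrices_carrier: "carrier (matrices k) = {..<k} \<times> {..<k} \<rightarrow>\<^sub>E R"
  by (simp add: matrix_monoid_def)

lemma sum_R: "(\<And>i. i \<in> S \<Longrightarrow> f i \<in> R) \<Longrightarrow> sum f S \<in> R"
  by (induction S rule: infinite_finite_induct) (auto intro: zero_R add_R)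

lemma matrices_mult:
  assumes "A \<in> carrier (matrices k)" "B \<in> carrier (matrices k)"
  shows "A \<otimes>\<^bsub>matrices k\<^esub> B = (\<lambda>(i, j)\<in>{..<k} \<times> {..<k}. \<Sum>l<k. A (i, l) * B (l, j))"
proof -
  have "(\<Oplus>\<^bsub>ring_on R\<^esub>l\<in>{..<k}. A (i, l) \<otimes>\<^bsub>ring_on R\<^esub> B (l, j)) = (\<Sum>l<k. A (i, l) * B (l, j))"
    if "i < k" "j < k" for i j
  proof (subst finsum_eq_sum)
    show "(\<lambda>l. A (i, l) \<otimes>\<^bsub>ring_on R\<^esub> B (l, j)) \<in> {..<k} \<rightarrow> carrier (ring_on R)"
      using assms that mult_R by (auto simp: matrices_carrier type_algebra_simps)
  qed (auto simp: type_algebra_simps zero_R add_R)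
  then show ?thesis
    by (auto simp: matrix_monoid_def fun_eq_iff restrict_def)
qed

lemma matrices_one:
  "\<one>\<^bsub>matrices k\<^esub> = (\<lambda>(i, j)\<in>{..<k} \<times> {..<k}. if i = j then 1 else 0)"
  by (auto simp: matrix_monoid_def type_algebra_simps fun_eq_iff restrict_def)

lemma matrices_nth: "A \<in> carrier (matrices k) \<Longrightarrow> i < k \<Longrightarrow> j < k \<Longrightarrow> A (i, j) \<in> R"
  by (auto simp: matrices_carrier)

lemma matrices_eqI:
  assumes "A \<in> carrier (matrices k)" "B \<in> carrier (matrices k)"
    "\<And>i j. i < k \<Longrightarrow> j < k \<Longrightarrow> A (i, j) = B (i, j)"
  shows "A = B"
  using assms by (intro PiE_ext[of A "{..<k} \<times> {..<k}" "\<lambda>_. R"]) (auto simp: matrices_carrier)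

lemma matrices_mult_closed:
  assumes "A \<in> carrier (matrices k)" "B \<in> carrier (matrices k)"
  shows "A \<otimes>\<^bsub>matrices k\<^esub> B \<in> carrier (matrices k)"
proof -
  have "(\<Sum>l<k. A (i, l) * B (l, j)) \<in> R" if "i < k" "j < k" for i j
    using that assms by (intro sum_R mult_R matrices_nth) auto
  then show ?thesis
    unfolding matrices_mult[OF assms] by (auto simp: matrices_carrier)
qed

text \<open>Gives access to the facts on units of a monoid, in particular that the general linear
  group is closed under products.\<close>

lemma monoid_matrices: "monoid (matrices k)"
proof (rule monoidI)
  show one: "\<one>\<^bsub>matrices k\<^esub> \<in> carrier (matrices k)"
    by (auto simp: matrices_one matrices_carrier one_R zero_R)
  fix A assume A: "A \<in> carrier (matrices k)"
  show "\<one>\<^bsub>matrices k\<^esub> \<otimes>\<^bsub>matrices k\<^esub> A = A"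
  proof (rule matrices_eqI[OF matrices_mult_closed[OF one A] A])
    fix i j assume "i < k" "j < k"
    then show "(\<one>\<^bsub>matrices k\<^esub> \<otimes>\<^bsub>matrices k\<^esub> A) (i, j) = A (i, j)"
      unfolding matrices_mult[OF one A]
      by (simp add: matrices_one if_distrib[of "\<lambda>x. x * _"] cong: if_cong)
  qed
  show "A \<otimes>\<^bsub>matrices k\<^esub> \<one>\<^bsub>matrices k\<^esub> = A"
  proof (rule matrices_eqI[OF matrices_mult_closed[OF A one] A])
    fix i j assume "i < k" "j < k"
    then show "(A \<otimes>\<^bsub>matrices k\<^esub> \<one>\<^bsub>matrices k\<^esub>) (i, j) = A (i, j)"
      unfolding matrices_mult[OF A one]
      by (simp add: matrices_one if_distrib[of "\<lambda>x. _ * x"] cong: if_cong)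
  qed
next
  fix A B C
  assume ABC: "A \<in> carrier (matrices k)" "B \<in> carrier (matrices k)" "C \<in> carrier (matrices k)"
  note cl = ABC matrices_mult_closed
  show "A \<otimes>\<^bsub>matrices k\<^esub> B \<otimes>\<^bsub>matrices k\<^esub> C = A \<otimes>\<^bsub>matrices k\<^esub> (B \<otimes>\<^bsub>matrices k\<^esub> C)"
  proof (rule matrices_eqI)
    fix i j assume ij: "i < k" "j < k"
    have "(A \<otimes>\<^bsub>matrices k\<^esub> B \<otimes>\<^bsub>matrices k\<^esub> C) (i, j) =
        (\<Sum>l<k. (A \<otimes>\<^bsub>matrices k\<^esub> B) (i, l) * C (l, j))"
      using ij cl by (subst matrices_mult) auto
    also have "\<dots> = (\<Sum>l<k. (\<Sum>m<k. A (i, m) * B (m, l)) * C (l, j))"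
      using ij ABC by (simp add: matrices_mult)
    also have "\<dots> = (\<Sum>m<k. A (i, m) * (\<Sum>l<k. B (m, l) * C (l, j)))"
      unfolding sum_distrib_left sum_distrib_right mult.assoc by (rule sum.swap)
    also have "\<dots> = (\<Sum>m<k. A (i, m) * (B \<otimes>\<^bsub>matrices k\<^esub> C) (m, j))"
      using ij ABC by (simp add: matrices_mult)
    also have "\<dots> = (A \<otimes>\<^bsub>matrices k\<^esub> (B \<otimes>\<^bsub>matrices k\<^esub> C)) (i, j)"
      using ij cl by (subst matrices_mult) auto
    finally show "(A \<otimes>\<^bsub>matrices k\<^esub> B \<otimes>\<^bsub>matrices k\<^esub> C) (i, j) =
        (A \<otimes>\<^bsub>matrices k\<^esub> (B \<otimes>\<^bsub>matrices k\<^esub> C)) (i, j)" .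
  qed (use cl in auto)
qed (rule matrices_mult_closed)

section \<open>The action on tuples and column additions\<close>

abbreviation act :: "nat \<Rightarrow> (nat \<Rightarrow> 'a) \<Rightarrow> (nat \<times> nat \<Rightarrow> 'a) \<Rightarrow> nat \<Rightarrow> 'a" where
  "act k \<equiv> row_times_matrix (ideal_module (ring_on R) I) k"

lemma act_eq:
  assumes "tuple k v" "A \<in> carrier (matrices k)"
  shows "act k v A = (\<lambda>j\<in>{..<k}. \<Sum>i<k. A (i, j) * v i)"
proof -
  have "finsum (ideal_module (ring_on R) I) (\<lambda>i. A (i, j) \<odot>\<^bsub>ideal_module (ring_on R) I\<^esub> v i) {..<k}
      = (\<Sum>i<k. A (i, j) * v i)" if "j < k" for j
  proof (subst finsum_eq_sum)
    show "(\<lambda>i. A (i, j) \<odot>\<^bsub>ideal_module (ring_on R) I\<^esub> v i) \<in> {..<k} \<rightarrow> carrier (ideal_module (ring_on R) I)"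
      using assms that I_mult tupleD[OF assms(1)] matrices_nth[OF assms(2)]
      by (auto simp: ideal_module_def type_algebra_simps)
  qed (auto simp: ideal_module_def type_algebra_simps I_0 I_add)
  then show ?thesis by (auto simp: row_times_matrix_def fun_eq_iff restrict_def)
qed

lemma act_tuple:
  assumes "tuple k v" "A \<in> carrier (matrices k)"
  shows "tuple k (act k v A)"
proof -
  have "(\<Sum>i\<in>S. A (i, j) * v i) \<in> I" if "j < k" "S \<subseteq> {..<k}" for j S
    using that(2)
    by (induction S rule: infinite_finite_induct)
      (use that(1) in \<open>auto intro!: I_0 I_add I_mult matrices_nth[OF assms(2)] tupleD[OF assms(1)]\<close>)
  then show ?thesis by (auto simp: tuple_def act_eq[OF assms])
qed

text \<open>A right action on rows, so successive operations multiply on the right. The double sums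
  are swapped and the scalars reordered by commutativity.\<close>

lemma act_act:
  assumes v: "tuple k v" and AB: "A \<in> carrier (matrices k)" "B \<in> carrier (matrices k)"
  shows "act k (act k v A) B = act k v (A \<otimes>\<^bsub>matrices k\<^esub> B)"
proof -
  have "(\<Sum>l<k. B (l, j) * (\<Sum>i<k. A (i, l) * v i)) = (\<Sum>i<k. (\<Sum>l<k. A (i, l) * B (l, j)) * v i)" for j
    unfolding sum_distrib_left sum_distrib_right
    by (subst sum.swap) (simp add: algebra_simps)
  then show ?thesis
    unfolding act_eq[OF act_tuple[OF v AB(1)] AB(2)] act_eq[OF v matrices_mult_closed[OF AB]]
    using AB v by (auto simp: act_eq matrices_mult fun_eq_iff restrict_def)
qed

text \<open>The identity matrix with \<open>r\<close> written off the diagonal into column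
  \<open>j\<close>. The diagonal test comes first, so \<open>r j\<close> is never read.\<close>

definition column_addition :: "nat \<Rightarrow> nat \<Rightarrow> (nat \<Rightarrow> 'a) \<Rightarrow> nat \<times> nat \<Rightarrow> 'a" where
  "column_addition k j r = (\<lambda>(i, l)\<in>{..<k} \<times> {..<k}.
     if i = l then 1 else if l = j then r i else 0)"

lemma column_addition_carrier:
  "r \<in> {..<k} - {j} \<rightarrow> R \<Longrightarrow> column_addition k j r \<in> carrier (matrices k)"
  by (auto simp: column_addition_def matrices_carrier one_R zero_R)

text \<open>Used with a matrix row as \<open>f\<close> for products, and with a tuple as
  \<open>f\<close> for the action.\<close>

lemma sum_column_addition:
  fixes f :: "nat \<Rightarrow> 'a"
  assumes "j < k" "l < k"
  shows "(\<Sum>i<k. f i * (if i = l then 1 else if l = j then r i else 0)) =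
    f l + (if l = j then \<Sum>i\<in>{..<k} - {j}. f i * r i else 0)"
proof -
  have "(\<Sum>i<k. f i * (if i = l then 1 else if l = j then r i else 0)) =
    f l + (\<Sum>i\<in>{..<k} - {l}. f i * (if i = l then 1 else if l = j then r i else 0))"
    using assms by (subst sum.remove[of _ l]) auto
  also have "(\<Sum>i\<in>{..<k} - {l}. f i * (if i = l then 1 else if l = j then r i else 0)) =
     (\<Sum>i\<in>{..<k} - {l}. if l = j then f i * r i else 0)"
    by (rule sum.cong) auto
  finally show ?thesis by auto
qed

text \<open>Columns other than \<open>j\<close> are unit vectors, so the off-diagonal parts add.
  Hence negating \<open>r\<close> gives the inverse matrix.\<close>

lemma column_addition_mult:
  assumes "j < k" "r \<in> {..<k} - {j} \<rightarrow> R" "s \<in> {..<k} - {j} \<rightarrow> R"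
  shows "column_addition k j r \<otimes>\<^bsub>matrices k\<^esub> column_addition k j s =
    column_addition k j (\<lambda>i. r i + s i)"
proof (rule matrices_eqI)
  note C = column_addition_carrier[OF assms(2)] column_addition_carrier[OF assms(3)]
  show "column_addition k j r \<otimes>\<^bsub>matrices k\<^esub> column_addition k j s \<in> carrier (matrices k)"
    by (rule matrices_mult_closed[OF C])
  show "column_addition k j (\<lambda>i. r i + s i) \<in> carrier (matrices k)"
    using assms add_R by (intro column_addition_carrier) auto
  fix i l assume il: "i < k" "l < k"
  have "(column_addition k j r \<otimes>\<^bsub>matrices k\<^esub> column_addition k j s) (i, l) =
     (\<Sum>m<k. column_addition k j r (i, m) * (if m = l then 1 else if l = j then s m else 0))"
    unfolding matrices_mult[OF C] using il by (simp add: column_addition_def)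
  also have "\<dots> = column_addition k j r (i, l) +
      (if l = j then \<Sum>m\<in>{..<k} - {j}. column_addition k j r (i, m) * s m else 0)"
    by (rule sum_column_addition[OF assms(1) il(2)])
  also have "(\<Sum>m\<in>{..<k} - {j}. column_addition k j r (i, m) * s m) =
      (\<Sum>m\<in>{..<k} - {j}. if m = i then s m else 0)"
    using il by (intro sum.cong) (auto simp: column_addition_def)
  \<comment> \<open>Row \<open>j\<close> gets 0, because the index \<open>j\<close> has been removed
    from the sum.\<close>
  also have "\<dots> = (if i = j then 0 else s i)"
    using il by (simp add: sum.delta)
  also have "column_addition k j r (i, l) + (if l = j then if i = j then 0 else s i else 0) =
     column_addition k j (\<lambda>i. r i + s i) (i, l)"
    using il by (auto simp: column_addition_def)
  finally show "(column_addition k j r \<otimes>\<^bsub>matrices k\<^esub> column_addition k j s) (i, l) =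
     column_addition k j (\<lambda>i. r i + s i) (i, l)" .
qed

lemma column_addition_GL:
  assumes "j < k" "r \<in> {..<k} - {j} \<rightarrow> R"
  shows "column_addition k j r \<in> general_linear (ring_on R) k"
proof -
  have one: "column_addition k j (\<lambda>_. 0) = \<one>\<^bsub>matrices k\<^esub>"
    by (auto simp: column_addition_def matrices_one fun_eq_iff restrict_def)
  have m: "(\<lambda>i. - r i) \<in> {..<k} - {j} \<rightarrow> R" using assms uminus_R by auto
  show ?thesis
    unfolding general_linear_def Units_def
    using column_addition_mult[OF assms m] column_addition_mult[OF assms(1) m assms(2)]
      column_addition_carrier[OF assms(2)] column_addition_carrier[OF m]
    by (auto simp: one intro!: bexI[of _ "column_addition k j (\<lambda>i. - r i)"])
qed

lemma act_column_addition:
  assumes v: "tuple k v" and "j < k" "r \<in> {..<k} - {j} \<rightarrow> R"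
  shows "act k v (column_addition k j r) = v(j := v j + (\<Sum>i\<in>{..<k} - {j}. r i * v i))"
proof
  fix l
  show "act k v (column_addition k j r) l = (v(j := v j + (\<Sum>i\<in>{..<k} - {j}. r i * v i))) l"
  proof (cases "l < k")
    case True
    have "act k v (column_addition k j r) l =
       (\<Sum>i<k. v i * (if i = l then 1 else if l = j then r i else 0))"
      unfolding act_eq[OF v column_addition_carrier[OF assms(3)]]
      using True by (auto simp: column_addition_def intro!: sum.cong)
    also have "\<dots> = v l + (if l = j then \<Sum>i\<in>{..<k} - {j}. v i * r i else 0)"
      by (rule sum_column_addition[OF assms(2) True])
    finally show ?thesis by (auto simp: mult.commute)
  next
    case False
    then show ?thesis
      using v assms(2) unfolding act_eq[OF v column_addition_carrier[OF assms(3)]]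
      by (auto simp: tuple_def PiE_def extensional_def)
  qed
qed

text \<open>Each step acts as a \<open>column_addition\<close>, which is appended on the right to
  the matrix of the preceding steps.\<close>

lemma elem_equiv_GL:
  assumes "elem_equiv k v w" "tuple k v"
  shows "\<exists>A\<in>general_linear (ring_on R) k. act k v A = w"
  using assms
proof (induction rule: elem_equiv.induct)
  case (elem_refl v)
  interpret monoid "matrices k" by (rule monoid_matrices)
  have "act k v \<one>\<^bsub>matrices k\<^esub> = v"
  proof
    fix j show "act k v \<one>\<^bsub>matrices k\<^esub> j = v j"
      using elem_refl unfolding act_eq[OF elem_refl one_closed]
      by (auto simp: matrices_one tuple_def PiE_def extensional_def if_distrib[of "\<lambda>x. x * _"]
          cong: if_cong)
  qed
  then show ?case using Units_one_closed by (auto simp: general_linear_def)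
next
  case (elem_step v w j z)
  interpret monoid "matrices k" by (rule monoid_matrices)
  obtain A where A: "A \<in> Units (matrices k)" "act k v A = w"
    using elem_step by (auto simp: general_linear_def)
  obtain r where r: "r \<in> {..<k} - {j} \<rightarrow> R" "z = (\<Sum>i\<in>{..<k} - {j}. r i * w i)"
    using elem_step by (auto simp: lincombs_def)
  have w: "tuple k w" using act_tuple A elem_step.prems Units_closed by blast
  let ?E = "column_addition k j r"
  have E: "?E \<in> Units (matrices k)"
    using column_addition_GL r elem_step by (auto simp: general_linear_def)
  have "act k v (A \<otimes>\<^bsub>matrices k\<^esub> ?E) = w(j := w j + z)"
    using act_act[OF elem_step.prems Units_closed[OF A(1)] Units_closed[OF E]]
      act_column_addition[OF w elem_step.hyps(2) r(1)] A(2) r(2) by simp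
  then show ?case using Units_m_closed[OF A(1) E] unfolding general_linear_def by blast
qed

text \<open>A submodule must also be closed under the inverse of the additive group of the record.
  That inverse is \<open>- x\<close>, and a subideal contains it.\<close>

lemma submodule_iff_subideal:
  "submodule N (ring_on R) (ideal_module (ring_on R) I) \<longleftrightarrow> subideal N"
proof
  assume "submodule N (ring_on R) (ideal_module (ring_on R) I)"
  then interpret submodule N "ring_on R" "ideal_module (ring_on R) I" .
  show "subideal N"
    unfolding subideal_def
    using subset one_closed m_closed smult_closed
    by (auto simp: ideal_module_def type_algebra_simps)
next
  assume N: "subideal N"
  let ?M = "add_monoid (ideal_module (ring_on R) I)"
  have inv: "inv\<^bsub>?M\<^esub> x = - x" if "x \<in> N" for x
    unfolding m_inv_def
    by (rule the_equality)
      (use that subidealD(1,6)[OF N] in \<open>auto simp: ideal_module_def type_algebra_simps eq_neg_iff_add_eq_0\<close>)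
  show "submodule N (ring_on R) (ideal_module (ring_on R) I)"
  proof (intro submodule.intro subgroup.intro submodule_axioms.intro)
    show "inv\<^bsub>?M\<^esub> x \<in> N" if "x \<in> N" for x
      using inv[OF that] subidealD(6)[OF N that] by simp
  qed (use subidealD[OF N] in \<open>auto simp: ideal_module_def type_algebra_simps\<close>)
qed

lemma generating_tuples_eq:
  "generating_tuples (ring_on R) (ideal_module (ring_on R) I) k = Collect (generating k)"
proof -
  have "generated_submodule (ring_on R) (ideal_module (ring_on R) I) (v ` {..<k}) = lincombs v {..<k}"
    if v: "tuple k v" for v
  proof
    have "subideal (lincombs v {..<k})"
      by (rule subideal_lincombs) (use tupleD[OF v] in simp)
    moreover have "v ` {..<k} \<subseteq> lincombs v {..<k}" using lincombs_base by blast
    ultimately show "generated_submodule (ring_on R) (ideal_module (ring_on R) I) (v ` {..<k})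
        \<subseteq> lincombs v {..<k}"
      unfolding generated_submodule_def submodule_iff_subideal by blast
    show "lincombs v {..<k} \<subseteq>
        generated_submodule (ring_on R) (ideal_module (ring_on R) I) (v ` {..<k})"
      unfolding generated_submodule_def submodule_iff_subideal
      by (intro Inter_greatest lincombs_least) auto
  qed
  then show ?thesis
    by (auto simp: generating_tuples_def generating_def tuple_def ideal_module_def)
qed

section \<open>Number of generators and linear rank\<close>

lemma GL_transitive_above_2:
  assumes "k > 2"
  shows "GL_transitive (ring_on R) (ideal_module (ring_on R) I) k"
  unfolding GL_transitive_def generating_tuples_eq
  using elem_equiv_GL generating_elem_equiv[OF assms] by (auto simp: generating_def)

lemma not_generating_below_2:
  assumes "k < 2"
  shows "\<not> generating k v"
proof
  assume v: "generating k v"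
  \<comment> \<open>The empty tuple generates the multiples of 0, so in both cases \<open>I\<close>
    would be the set of multiples of \<open>d\<close>.\<close>
  define d where "d = (if k = 0 then 0 else v 0)"
  have d: "d \<in> I" using v I_0 tupleD by (auto simp: d_def generating_def)
  have "v i \<in> multiples d" if "i < k" for i
    using that assms multiples_self by (simp add: d_def less_2_cases_iff)
  then have "multiples d = I" by (rule generatingD[OF v subideal_multiples[OF d]])
  then show False using nonprincipal[OF d] by (auto simp: multiples_def)
qed

lemma generating_pair: "\<exists>v. generating 2 v"
proof -
  obtain e1 e2 where e: "e1 \<in> I" "e2 \<in> I" "\<And>z. z \<in> I \<Longrightarrow> \<exists>s t. z = of_int s * e1 + of_int t * e2"
    using planar by blast
  define v where "v = (\<lambda>i\<in>{..<2::nat}. if i = 0 then e1 else e2)"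
  have tup: "tuple 2 v" using e by (auto simp: tuple_def v_def)
  have sub: "subideal (lincombs v {..<2})"
    by (rule subideal_lincombs) (use tupleD[OF tup] in simp)
  have "v 0 \<in> lincombs v {..<2}" "v 1 \<in> lincombs v {..<2}" by (intro lincombs_base; simp)+
  then have "e1 \<in> lincombs v {..<2}" "e2 \<in> lincombs v {..<2}" by (simp_all add: v_def)
  then have "I \<subseteq> lincombs v {..<2}" using e(3) subidealD(3,5)[OF sub] by (metis subsetI)
  then have "generating 2 v"
    using tup subidealD(1)[OF sub] unfolding generating_def by blast
  then show ?thesis by blast
qed

text \<open>The admissible integers start at the minimal number of generators, which is already 2,
  and transitivity above 2 makes 2 admissible.\<close>

lemma glr_eq_2: "glr (ring_on R) (ideal_module (ring_on R) I) = 2"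
proof -
  have mu: "min_generators (ring_on R) (ideal_module (ring_on R) I) = enat 2"
    unfolding min_generators_def generating_tuples_eq
  proof (rule antisym)
    show "Inf {enat k |k. Collect (generating k) \<noteq> {}} \<le> enat 2"
      by (rule Inf_lower) (use generating_pair in blast)
    show "enat 2 \<le> Inf {enat k |k. Collect (generating k) \<noteq> {}}"
      by (rule Inf_greatest) (use not_generating_below_2 in \<open>auto simp: linorder_not_less[symmetric]\<close>)
  qed
  have "glr (ring_on R) (ideal_module (ring_on R) I) = enat 2"
    unfolding glr_def mu
  proof (rule antisym)
    let ?S = "{enat n |n. enat 2 \<le> enat n \<and>
      (\<forall>k>n. GL_transitive (ring_on R) (ideal_module (ring_on R) I) k)}"
    show "Inf ?S \<le> enat 2"
      by (rule Inf_lower) (use GL_transitive_above_2 in blast)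
    show "enat 2 \<le> Inf ?S" by (rule Inf_greatest) auto
  qed
  then show ?thesis by (simp add: numeral_eq_enat)
qed

end

text \<open>Nonprincipality is among the hypotheses because a principal ideal of a domain never has
  linear rank 2, by \<open>glr_neq_2_of_principalideal\<close>.\<close>

theorem proposition6p6:
  fixes K R I :: "'a :: field_char_0 set"
  assumes "quadratic_number_field K"
    and "order_in K R"
    and "ideal I (ring_on R)"
    and "\<not> principalideal I (ring_on R)"
  shows "glr (ring_on R) (ideal_module (ring_on R) I) = 2"
proof -
  interpret ideal I "ring_on R" by fact
  have R_one: "1 \<in> R" and R_mult: "\<And>x y. x \<in> R \<Longrightarrow> y \<in> R \<Longrightarrow> x * y \<in> R"
    using one_closed m_closed by (simp_all add: type_algebra_simps)
  have R_add: "x + y \<in> R" if "x \<in> R" "y \<in> R" for x y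
    using add.m_closed[of x y] that by (simp add: type_algebra_simps)
  have R_uminus: "- x \<in> R" if "x \<in> R" for x
    using add.l_inv_ex[of x] that by (auto simp: type_algebra_simps add_eq_0_iff2)
  have I_sub: "I \<subseteq> R" using a_subset by simp
  have I_0: "0 \<in> I" using additive_subgroup.zero_closed[OF is_additive_subgroup]
    by (simp add: type_algebra_simps)
  have I_add: "x + y \<in> I" if "x \<in> I" "y \<in> I" for x y
    using additive_subgroup.a_closed[OF is_additive_subgroup that] by (simp add: type_algebra_simps)
  have I_mult: "r * x \<in> I" if "r \<in> R" "x \<in> I" for r x
    using I_l_closed[of x r] that by (simp add: type_algebra_simps)
  have "subring R (ring_on (ring_of_integers K))" using assms(2) by (simp add: order_in_def)
  then have "R \<subseteq> ring_of_integers K"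
    using subgroup.subset[OF subring.axioms(1)] by fastforce
  then have RK: "R \<subseteq> K" and alg: "\<And>x. x \<in> R \<Longrightarrow> algebraic_int x"
    by (auto simp: ring_of_integers_def)
  obtain u1 u2 where K: "K = {a * u1 + b * u2 |a b. a \<in> \<rat> \<and> b \<in> \<rat>}"
    using quadratic_number_field_span[OF assms(1)] by blast
  \<comment> \<open>\<open>R\<close> lies in a group with two generators over the integers, and its
    subgroup \<open>I\<close> inherits a pair of generators.\<close>
  obtain f1 f2 where f: "\<And>x. x \<in> R \<Longrightarrow> \<exists>s t. x = of_int s * f1 + of_int t * f2"
    using integral_ring_in_two_dim[OF K RK R_one R_mult alg] by blast
  have I_diff: "x - y \<in> I" if "x \<in> I" "y \<in> I" for x y
    using I_add[OF that(1) I_mult[OF R_uminus[OF R_one] that(2)]] by simp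
  have "nonprincipal_planar_ideal R I"
  proof
    show "\<exists>e1\<in>I. \<exists>e2\<in>I. \<forall>z\<in>I. \<exists>s t. z = of_int s * e1 + of_int t * e2"
      by (rule subgroup_of_two_generated[OF I_0 I_diff]) (use f I_sub in blast)+
    show "\<exists>z\<in>I. \<forall>r\<in>R. z \<noteq> r * d" if d: "d \<in> I" for d
    proof (rule ccontr)
      assume *: "\<not> (\<exists>z\<in>I. \<forall>r\<in>R. z \<noteq> r * d)"
      \<comment> \<open>If all of \<open>I\<close> consists of multiples of \<open>d\<close>, every
        ideal containing \<open>d\<close> contains \<open>I\<close>, so \<open>I\<close> is the
        ideal generated by \<open>d\<close>.\<close>
      have "J \<supseteq> I" if J: "ideal J (ring_on R)" "d \<in> J" for J
        using * ideal.I_l_closed[OF J(1,2)] by (auto simp: type_algebra_simps)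
      then have "I = Idl\<^bsub>ring_on R\<^esub> {d}"
        unfolding genideal_def using assms(3) d by blast
      then have "principalideal I (ring_on R)"
        using d I_sub by (intro principalidealI[OF assms(3)]) auto
      then show False using assms(4) by blast
    qed
  qed (use R_one R_add R_uminus R_mult alg I_sub I_0 I_add I_mult in auto)
  then show ?thesis by (rule nonprincipal_planar_ideal.glr_eq_2)
qed

end
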